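(* Let $X$ be a set of cardinality $\kappa$ with $\kappa \rightarrow (\kappa)^2_2$. If $\mathcal{R} = (X, \mathbf{R})$ is a relational structure on $X$ such that $|\mathbf{R}| < \kappa$ and the set $\{ \operatorname{dim}(R) \mid R \in \mathbf{R} \}$ is bounded in $\omega$, then $\operatorname{pAut}(\mathcal{R}) \approx_I I_X$.
   Context: For a set $X$, $I_X$ is the symmetric inverse monoid: the set of all bijections between subsets of $X$ (partial bijections, called charts) under composition of partial functions, written left to right (the image of $x$ under $f$ is $xf$). For subsemigroups $S_1, S_2$ of $I_X$, write $S_1 \preccurlyeq_I S_2$ if there is a finite set $U \subseteq I_X$ such that $S_1 \subseteq \langle S_2 \cup U \rangle$, where $\langle\cdot\rangle$ denotes the semigroup generated; $S_1 \approx_I S_2$ means $S_1 \preccurlyeq_I S_2$ and $S_2 \preccurlyeq_I S_1$. For cardinals $\kappa,\lambda,\mu$ and $n \in \omega$, $\kappa \rightarrow (\lambda)^n_\mu$ means: for every partition of the set $[\kappa]^n$ of $n$-element subsets of $\kappa$ into $\mu$ parts there is a subset $H \subseteq \kappa$ of cardinality $\lambda$ such that $[H]^n$ is contained in a single part. A relational structure $\mathcal{R} = (X,\mathbf{R})$ on $X$ consists of $X$ together with a set $\mathbf{R}$ of relations on $X$, each $R \in \mathbf{R}$ being a subset of $X^{n}$ for some natural number $n = \operatorname{dim}(R)$, its arity. For $\alpha = (a_0,\dots,a_{n-1}) \in \operatorname{dom}(f)^n$, $\alpha f = (a_0 f, \dots, a_{n-1} f)$. $\operatorname{pAut}(\mathcal{R})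 = \{ f \in I_X \mid (\forall R \in \mathbf{R})(\forall \alpha \in \operatorname{dom}(f)^{\operatorname{dim}(R)})\ \alpha f \in R \Leftrightarrow \alpha \in R \}$ is the inverse monoid of partial automorphisms of $\mathcal{R}$. *)

theory Defs
  imports Main "HOL-Library.Ramsey" "HOL-Library.NList" "HOL-Library.Disjoint_Sets"
begin

unbundle cardinal_syntax

text \<open>
  Charts of \<open>X\<close> are partial maps \<open>f :: 'a \<rightharpoonup> 'a\<close>. The library's \<open>map_comp\<close> composes from right
  to left, so the left-to-right product \<open>fg\<close> (first \<open>f\<close>, then \<open>g\<close>) is \<open>g \<circ>\<^sub>m f\<close>.
\<close>

definition sym_inv_monoid :: "'a set \<Rightarrow> ('a \<rightharpoonup> 'a) set"
  where "sym_inv_monoid X = {f. dom f \<subseteq> X \<and> ran f \<subseteq> X \<and> inj_on f (dom f)}"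

definition chart_mult :: "('a \<rightharpoonup> 'a) \<Rightarrow> ('a \<rightharpoonup> 'a) \<Rightarrow> ('a \<rightharpoonup> 'a)"  (infixl "\<cdot>\<^sub>c" 70)
  where "f \<cdot>\<^sub>c g = g \<circ>\<^sub>m f"

inductive_set sgen :: "('a \<rightharpoonup> 'a) set \<Rightarrow> ('a \<rightharpoonup> 'a) set" for A
  where
    base: "f \<in> A \<Longrightarrow> f \<in> sgen A"
  | mult: "f \<in> sgen A \<Longrightarrow> g \<in> sgen A \<Longrightarrow> f \<cdot>\<^sub>c g \<in> sgen A"

definition preceq_I :: "'a set \<Rightarrow> ('a \<rightharpoonup> 'a) set \<Rightarrow> ('a \<rightharpoonup> 'a) set \<Rightarrow> bool"
  where "preceq_I X S\<^sub>1 S\<^sub>2 \<longleftrightarrow>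
    (\<exists>U. finite U \<and> U \<subseteq> sym_inv_monoid X \<and> S\<^sub>1 \<subseteq> sgen (S\<^sub>2 \<union> U))"

definition approx_I :: "'a set \<Rightarrow> ('a \<rightharpoonup> 'a) set \<Rightarrow> ('a \<rightharpoonup> 'a) set \<Rightarrow> bool"
  where "approx_I X S\<^sub>1 S\<^sub>2 \<longleftrightarrow> preceq_I X S\<^sub>1 S\<^sub>2 \<and> preceq_I X S\<^sub>2 S\<^sub>1"

text \<open>
  The partition relation \<open>\<kappa> \<rightarrow> (\<nu>)\<^sup>n\<^sub>\<mu>\<close>. Cardinals are cardinal orders, represented on their
  fields. As usual in the partition calculus, a partition into \<open>\<mu>\<close> parts is a disjoint family
  indexed by \<open>\<mu>\<close> whose members may be empty (that is, a colouring with \<open>\<mu>\<close> colours).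
\<close>

definition partition_arrow :: "'k rel \<Rightarrow> 'l rel \<Rightarrow> nat \<Rightarrow> 'm rel \<Rightarrow> bool"
  where "partition_arrow \<kappa> \<nu> n \<mu> \<longleftrightarrow>
    (\<forall>P. disjoint_family_on P (Field \<mu>) \<and> (\<Union>i\<in>Field \<mu>. P i) = [Field \<kappa>]\<^bsup>n\<^esup> \<longrightarrow>
      (\<exists>H i. H \<subseteq> Field \<kappa> \<and> |H| =o \<nu> \<and> i \<in> Field \<mu> \<and> [H]\<^bsup>n\<^esup> \<subseteq> P i))"

text \<open>
  An \<open>n\<close>-tuple over \<open>X\<close> is a list in \<open>nlists n X\<close>. The arity is given by a function \<open>ar\<close> on the
  relations and is not read off the tuples, since it would then be undetermined for the
  empty relation.
\<close>

definition relational_structure ::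
    "'a set \<Rightarrow> 'a list set set \<Rightarrow> ('a list set \<Rightarrow> nat) \<Rightarrow> bool"
  where "relational_structure X Rs ar \<longleftrightarrow> (\<forall>R\<in>Rs. R \<subseteq> nlists (ar R) X)"

definition pAut ::
    "'a set \<Rightarrow> 'a list set set \<Rightarrow> ('a list set \<Rightarrow> nat) \<Rightarrow> ('a \<rightharpoonup> 'a) set"
  where "pAut X Rs ar = {f \<in> sym_inv_monoid X.
    \<forall>R\<in>Rs. \<forall>\<alpha>\<in>nlists (ar R) (dom f). map (\<lambda>a. the (f a)) \<alpha> \<in> R \<longleftrightarrow> \<alpha> \<in> R}"

end

theory Submission
  imports Defs
begin

text \<open>
  For finite \<open>X\<close> the generating set \<open>U = I\<^sub>X\<close> will do. For infinite \<open>X\<close>, well-order \<open>X\<close> in type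
  \<open>\<kappa>\<close>. The partition relation for pairs makes \<open>\<kappa>\<close> regular and, applied to a lexicographic order of
  binary sequences, gives for every family of at most \<open>\<kappa>\<close> subsets of \<open>X\<close> a set \<open>H\<close> of size \<open>\<kappa>\<close> on
  which each member of the family is, up to fewer than \<open>\<kappa>\<close> points, empty or everything. By induction
  on the arity this yields \<open>H\<close> of size \<open>\<kappa>\<close> that is order-indiscernible for all relations, so every
  order-preserving chart of \<open>H\<close> is a partial automorphism.

  These charts and three fixed ones generate \<open>I\<^sub>X\<close>. If \<open>f\<close> maps blocks (intervals, each of size less
  than \<open>\<kappa>\<close>) into themselves, then with \<open>\<nu> x\<close> the block of \<open>x\<close> both \<open>x \<mapsto> (\<nu> x, x, x f)\<close> and
  \<open>(\<nu> x, x f, x) \<mapsto> x f\<close> preserve the lexicographic order, and the swap between them does not depend on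
  \<open>f\<close>. An arbitrary \<open>f\<close> is a product of order-preserving charts and two block preserving ones,
  because two disjoint sets of cut points can be chosen so sparse that no step from \<open>x\<close> to \<open>x f\<close> crosses
  cuts of both sets.
\<close>

section \<open>Cardinal arithmetic\<close>

text \<open>As simp rules, these two make the simplifier loop on \<open>nlists_def\<close>.\<close>

declare nlistsE_length [simp del] nlistsE_set [simp del]

lemma finite_ordLess_infinite_card:
  assumes "finite A" "infinite X"
  shows "|A| <o |X|"
  using finite_ordLess_infinite[OF card_of_Well_order card_of_Well_order] assms
  by (simp add: Field_card_of)

text \<open>Two finite factors have a finite product. Otherwise the product embeds in the square of
  the infinite disjoint sum, and that square is equipotent to the sum, so the larger factor need not
  be singled out.\<close>

lemma card_of_Times_ordLess:
  assumes "infinite X" "|A| <o |X|" "|B| <o |X|"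
  shows "|A \<times> B| <o |X|"
proof (cases "finite (A <+> B)")
  case True
  then have "finite A" "finite B" by (simp_all add: finite_Plus_iff)
  then show ?thesis using assms(1) by (intro finite_ordLess_infinite_card) auto
next
  case False
  have "inj_on (map_prod Inl Inr) (A \<times> B)" by (auto simp: inj_on_def)
  moreover have "map_prod Inl Inr ` (A \<times> B) \<subseteq> (A <+> B) \<times> (A <+> B)" by auto
  ultimately have "|A \<times> B| \<le>o |(A <+> B) \<times> (A <+> B)|" using card_of_ordLeq by blast
  also have "|(A <+> B) \<times> (A <+> B)| =o |A <+> B|"
    using False by (rule card_of_Times_same_infinite)
  also have "|A <+> B| <o |X|" using assms by (rule card_of_Plus_ordLess_infinite)
  finally show ?thesis .
qed

lemma card_of_Times_ordLeq:
  assumes "infinite X" "|A| \<le>o |X|" "|B| \<le>o |X|"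
  shows "|A \<times> B| \<le>o |X|"
  using card_of_Sigma_ordLeq_infinite[OF assms(1,2), of "\<lambda>_. B"] assms(3) by simp

lemma card_of_nlists_ordLess:
  assumes "infinite X" "|S| <o |X|"
  shows "|nlists n S| <o |X|"
proof (induction n)
  case 0
  then show ?case using assms(1) finite_ordLess_infinite_card[of "{[]}" X] by simp
next
  case (Suc n)
  have "nlists (Suc n) S = (\<lambda>(a, l). a # l) ` (S \<times> nlists n S)"
    by (auto simp: nlists_Suc)
  then have "|nlists (Suc n) S| \<le>o |S \<times> nlists n S|" by (simp only: card_of_image)
  then show ?case
    using card_of_Times_ordLess[OF assms(1,2) Suc] ordLeq_ordLess_trans by blast
qed

lemma card_of_nlists_ordLeq:
  assumes "infinite X" "|S| \<le>o |X|"
  shows "|nlists n S| \<le>o |X|"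
proof (induction n)
  case 0
  then show ?case using assms(1) finite_ordLess_infinite_card[of "{[]}" X] ordLess_imp_ordLeq by auto
next
  case (Suc n)
  have "nlists (Suc n) S = (\<lambda>(a, l). a # l) ` (S \<times> nlists n S)"
    by (auto simp: nlists_Suc)
  then have "|nlists (Suc n) S| \<le>o |S \<times> nlists n S|" by (simp only: card_of_image)
  also have "|S \<times> nlists n S| \<le>o |X|"
    using card_of_Times_ordLeq[OF assms Suc] .
  finally show ?case .
qed

section \<open>The partition relation for pairs\<close>

text \<open>This transports the arrow from the field of \<open>\<kappa>\<close> along a bijection to
  any set of that cardinality, in the form used below: a binary predicate evaluated on pairs in
  increasing order.\<close>

lemma partition_arrow_two_colours:
  fixes Q :: "'a \<Rightarrow> 'a \<Rightarrow> bool" and less :: "'a \<Rightarrow> 'a \<Rightarrow> bool" (infix "\<sqsubset>" 50)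
  assumes arrow: "partition_arrow \<kappa> \<kappa> 2 ctwo" and "Card_order \<kappa>" and Y: "|Y| =o \<kappa>"
    and asym: "\<And>x y. x \<sqsubset> y \<Longrightarrow> \<not> y \<sqsubset> x"
  shows "\<exists>H\<subseteq>Y. |H| =o |Y| \<and>
    ((\<forall>x\<in>H. \<forall>y\<in>H. x \<sqsubset> y \<longrightarrow> Q x y) \<or> (\<forall>x\<in>H. \<forall>y\<in>H. x \<sqsubset> y \<longrightarrow> \<not> Q x y))"
proof -
  have "|Field \<kappa>| =o |Y|"
    by (rule ordIso_transitive[OF card_of_Field_ordIso[OF assms(2)] ordIso_symmetric[OF Y]])
  then obtain \<phi> where \<phi>: "bij_betw \<phi> (Field \<kappa>) Y" by (meson card_of_ordIso)
  \<comment> \<open>By asymmetry a pair is increasing in at most one of its two orders, so the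
    colour of an ordered pair is the value of \<open>Q\<close> on it. Colours are truth values
    because \<open>ctwo\<close> lives on \<open>bool\<close>.\<close>
  define c where "c S \<longleftrightarrow> (\<forall>x\<in>S. \<forall>y\<in>S. \<phi> x \<sqsubset> \<phi> y \<longrightarrow> Q (\<phi> x) (\<phi> y))" for S
  define P where "P b = {S \<in> [Field \<kappa>]\<^bsup>2\<^esup>. c S = b}" for b
  have "disjoint_family_on P (Field ctwo)" "(\<Union>i\<in>Field ctwo. P i) = [Field \<kappa>]\<^bsup>2\<^esup>"
    by (auto simp: disjoint_family_on_def P_def ctwo_def Field_card_of)
  then obtain H b where H: "H \<subseteq> Field \<kappa>" "|H| =o \<kappa>" "[H]\<^bsup>2\<^esup> \<subseteq> P b"
    using arrow[unfolded partition_arrow_def, THEN spec, of P] by blast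
  have inj: "inj_on \<phi> H" using \<phi> H(1) by (meson bij_betw_def inj_on_subset)
  have "|\<phi> ` H| =o |Y|"
  proof -
    have "|H| =o |\<phi> ` H|" using inj card_of_ordIso inj_on_imp_bij_betw by blast
    then show ?thesis
      by (rule ordIso_transitive[OF ordIso_symmetric ordIso_transitive[OF H(2) ordIso_symmetric[OF Y]]])
  qed
  moreover have "\<phi> ` H \<subseteq> Y" using \<phi> H(1) by (auto simp: bij_betw_def)
  moreover have "Q (\<phi> x) (\<phi> y) = b" if "x \<in> H" "y \<in> H" "\<phi> x \<sqsubset> \<phi> y" for x y
  proof -
    have "x \<noteq> y" using asym that(3) by metis
    then have "{x, y} \<in> [H]\<^bsup>2\<^esup>" using that by (auto simp: nsets_def)
    then have "c {x, y} = b" using H(3) unfolding P_def by blast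
    then show ?thesis using asym that(3) by (auto simp: c_def)
  qed
  ultimately show ?thesis by (intro exI[of _ "\<phi> ` H"]) (cases b; auto)
qed

section \<open>Large and small subsets of a well-order of type \<open>\<kappa>\<close>\<close>

locale ramsey_order =
  fixes X :: "'a set" and less :: "'a \<Rightarrow> 'a \<Rightarrow> bool" (infix "\<sqsubset>" 50)
  assumes infinite: "infinite X"
    and wf_less: "wf {(x, y). x \<sqsubset> y}"
    and less_trans: "x \<sqsubset> y \<Longrightarrow> y \<sqsubset> z \<Longrightarrow> x \<sqsubset> z"
    and less_total: "x \<in> X \<Longrightarrow> y \<in> X \<Longrightarrow> x \<noteq> y \<Longrightarrow> x \<sqsubset> y \<or> y \<sqsubset> x"
    and card_segment: "x \<in> X \<Longrightarrow> |{y \<in> X. y \<sqsubset> x}| <o |X|"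
    and ramsey: "Y \<subseteq> X \<Longrightarrow> |Y| =o |X| \<Longrightarrow> \<exists>H\<subseteq>Y. |H| =o |Y| \<and>
      ((\<forall>x\<in>H. \<forall>y\<in>H. x \<sqsubset> y \<longrightarrow> Q x y) \<or> (\<forall>x\<in>H. \<forall>y\<in>H. x \<sqsubset> y \<longrightarrow> \<not> Q x y))"
begin

abbreviation small :: "'b set \<Rightarrow> bool" where "small S \<equiv> |S| <o |X|"

definition large :: "'a set \<Rightarrow> bool" where "large A \<longleftrightarrow> A \<subseteq> X \<and> |A| =o |X|"

abbreviation less_eq :: "'a \<Rightarrow> 'a \<Rightarrow> bool" (infix "\<sqsubseteq>" 50) where "x \<sqsubseteq> y \<equiv> x = y \<or> x \<sqsubset> y"

lemma less_asym: "x \<sqsubset> y \<Longrightarrow> \<not> y \<sqsubset> x"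
  using wf_not_sym[OF wf_less] by auto

lemma less_irrefl: "\<not> x \<sqsubset> x"
  using less_asym by blast

lemma not_less_iff: "x \<in> X \<Longrightarrow> y \<in> X \<Longrightarrow> \<not> x \<sqsubset> y \<longleftrightarrow> y \<sqsubseteq> x"
  using less_total less_asym less_irrefl by blast

lemma ramsey_large:
  assumes "large Y"
  obtains H where "large H" "H \<subseteq> Y" "\<And>x y. x \<in> H \<Longrightarrow> y \<in> H \<Longrightarrow> x \<sqsubset> y \<Longrightarrow> Q x y"
  | H where "large H" "H \<subseteq> Y" "\<And>x y. x \<in> H \<Longrightarrow> y \<in> H \<Longrightarrow> x \<sqsubset> y \<Longrightarrow> \<not> Q x y"
proof -
  have Y: "Y \<subseteq> X" "|Y| =o |X|" using assms by (auto simp: large_def)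
  obtain H where H: "H \<subseteq> Y" "|H| =o |Y|"
    "(\<forall>x\<in>H. \<forall>y\<in>H. x \<sqsubset> y \<longrightarrow> Q x y) \<or> (\<forall>x\<in>H. \<forall>y\<in>H. x \<sqsubset> y \<longrightarrow> \<not> Q x y)"
    using ramsey[OF Y, of Q] by auto
  have "large H" using H(1,2) Y ordIso_transitive[OF H(2) Y(2)] by (auto simp: large_def)
  then show thesis using H that by blast
qed

lemma large_UNIV: "large X" by (simp add: large_def card_of_refl)

lemma largeD: "large A \<Longrightarrow> x \<in> A \<Longrightarrow> x \<in> X" by (auto simp: large_def)

lemma small_subset: "A \<subseteq> B \<Longrightarrow> small B \<Longrightarrow> small A"
  using card_of_mono1 ordLeq_ordLess_trans by blast

lemma small_image: "small A \<Longrightarrow> small (f ` A)"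
  using card_of_image ordLeq_ordLess_trans by blast

lemma small_finite: "finite A \<Longrightarrow> small A"
  using infinite by (intro finite_ordLess_infinite_card)

lemma small_Un: "small A \<Longrightarrow> small B \<Longrightarrow> small (A \<union> B)"
  using card_of_Un_ordLess_infinite[OF infinite] by blast

lemma small_Times: "small A \<Longrightarrow> small B \<Longrightarrow> small (A \<times> B)"
  using card_of_Times_ordLess[OF infinite] by blast

lemma large_not_small: "large A \<Longrightarrow> \<not> small A"
  using not_ordLess_ordIso[of "|A|" "|X|"] by (auto simp: large_def)

lemma not_small_large: "A \<subseteq> X \<Longrightarrow> \<not> small A \<Longrightarrow> large A"
  unfolding large_def using card_of_mono1[of A X] ordLeq_iff_ordLess_or_ordIso[of "|A|" "|X|"] by blast

lemma small_segment: "b \<in> X \<Longrightarrow> small {y \<in> X. y \<sqsubseteq> b}"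
proof -
  assume "b \<in> X"
  then have "small ({y \<in> X. y \<sqsubset> b} \<union> {b})"
    by (intro small_Un card_segment small_finite) auto
  then show ?thesis by (rule small_subset[rotated]) auto
qed

lemma large_minus_small: "large A \<Longrightarrow> small B \<Longrightarrow> large (A - B)"
proof (rule not_small_large)
  assume "large A" "small B"
  show "\<not> small (A - B)"
  proof
    assume "small (A - B)"
    then have "small ((A - B) \<union> B)" using \<open>small B\<close> by (rule small_Un)
    then have "small A" by (rule small_subset[rotated]) auto
    then show False using \<open>large A\<close> large_not_small by blast
  qed
qed (auto simp: large_def)

lemma large_above:
  assumes "large A" "b \<in> X"
  shows "large {x \<in> A. b \<sqsubset> x}"
proof -
  have "large (A - {y \<in> X. y \<sqsubseteq> b})" using assms small_segment large_minus_small by blast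
  moreover have "A - {y \<in> X. y \<sqsubseteq> b} = {x \<in> A. b \<sqsubset> x}"
    using assms not_less_iff[of b] by (auto simp: large_def)
  ultimately show ?thesis by simp
qed

lemma large_nonempty: "large A \<Longrightarrow> \<exists>x. x \<in> A"
  using large_not_small small_finite by (metis all_not_in_conv finite.emptyI)

lemma large_unbounded:
  assumes "large A" "b \<in> X"
  shows "\<exists>x\<in>A. b \<sqsubset> x"
  using large_above[OF assms] large_nonempty by blast

text \<open>This is the regularity of \<open>\<kappa>\<close>. If \<open>S\<close> had no strict
  upper bound, each \<open>x\<close> could be sent to some \<open>g x\<close> in \<open>S\<close> at
  or above it. On a large set homogeneous for \<open>g x = g y\<close>, the map \<open>g\<close> is
  either constant, which bounds that set, or injective, which makes it no larger than
  \<open>S\<close>.\<close>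

lemma small_bounded:
  assumes "S \<subseteq> X" "small S"
  obtains b where "b \<in> X" "\<And>s. s \<in> S \<Longrightarrow> s \<sqsubset> b"
proof (rule ccontr)
  assume "\<not> thesis"
  then have "\<forall>x\<in>X. \<exists>s\<in>S. x \<sqsubseteq> s" using that assms(1) less_total by (metis subsetD)
  then obtain g where g: "\<And>x. x \<in> X \<Longrightarrow> g x \<in> S \<and> x \<sqsubseteq> g x" by metis
  obtain H where H: "large H" and
    "(\<forall>x\<in>H. \<forall>y\<in>H. x \<sqsubset> y \<longrightarrow> g x = g y) \<or> (\<forall>x\<in>H. \<forall>y\<in>H. x \<sqsubset> y \<longrightarrow> g x \<noteq> g y)"
    by (rule ramsey_large[OF large_UNIV, of "\<lambda>x y. g x = g y"]) blast+
  then consider "\<forall>x\<in>H. \<forall>y\<in>H. x \<sqsubset> y \<longrightarrow> g x = g y" | "\<forall>x\<in>H. \<forall>y\<in>H. x \<sqsubset> y \<longrightarrow> g x \<noteq> g y"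
    by blast
  then show False
  proof cases
    case 1
    obtain x0 where "x0 \<in> H" using H large_nonempty by blast
    then have "x0 \<in> X" using H largeD by blast
    have "x \<in> X \<and> x \<sqsubseteq> g x0" if "x \<in> H" for x
    proof -
      have "x \<in> X" using that H largeD by blast
      moreover have "g x = g x0" using 1 that \<open>x0 \<in> H\<close> less_total[OF \<open>x \<in> X\<close> \<open>x0 \<in> X\<close>] by metis
      ultimately show ?thesis using g by metis
    qed
    then have "H \<subseteq> {y \<in> X. y \<sqsubseteq> g x0}" by blast
    moreover have "g x0 \<in> X" using g[OF \<open>x0 \<in> X\<close>] assms(1) by blast
    ultimately show False using small_segment small_subset large_not_small H by blast
  next
    case 2
    then have "inj_on g H" unfolding inj_on_def using H less_total largeD by metis
    moreover have "g ` H \<subseteq> S" using g H largeD by blast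
    ultimately have "|H| \<le>o |S|" using card_of_ordLeq by blast
    then have "small H" using assms(2) ordLeq_ordLess_trans by blast
    then show False using H large_not_small by blast
  qed
qed

lemma small_image_bounded:
  assumes "small I" "\<And>i. i \<in> I \<Longrightarrow> f i \<in> X"
  shows "\<exists>b\<in>X. \<forall>i\<in>I. f i \<sqsubset> b"
proof -
  have "f ` I \<subseteq> X" "small (f ` I)" using assms small_image by auto
  then obtain b where "b \<in> X" "\<And>s. s \<in> f ` I \<Longrightarrow> s \<sqsubset> b"
    by (rule small_bounded) blast
  then show ?thesis by blast
qed

text \<open>The other colour cannot occur: a large set is unbounded, so beyond any of its points
  \<open>x\<close> it has a point above both \<open>x\<close> and \<open>b x\<close>.\<close>

lemma sparse_subset:
  assumes "large Y" "\<And>x. x \<in> X \<Longrightarrow> b x \<in> X"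
  obtains H where "large H" "H \<subseteq> Y" "\<And>x y. x \<in> H \<Longrightarrow> y \<in> H \<Longrightarrow> x \<sqsubset> y \<Longrightarrow> b x \<sqsubset> y"
proof (rule ramsey_large[OF assms(1), of "\<lambda>x y. b x \<sqsubset> y"])
  fix H assume H: "large H" and no: "\<And>x y. x \<in> H \<Longrightarrow> y \<in> H \<Longrightarrow> x \<sqsubset> y \<Longrightarrow> \<not> b x \<sqsubset> y"
  obtain x where x: "x \<in> H" using H large_nonempty by blast
  then have "x \<in> X" using H largeD by blast
  have "{x, b x} \<subseteq> X" "small {x, b x}"
    using assms(2) \<open>x \<in> X\<close> by (auto intro!: small_finite)
  then obtain c where "c \<in> X" "x \<sqsubset> c" "b x \<sqsubset> c"
    by (rule small_bounded) simp
  then obtain y where "y \<in> H" "c \<sqsubset> y" using large_unbounded H by blast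
  then show thesis using no x \<open>x \<sqsubset> c\<close> \<open>b x \<sqsubset> c\<close> less_trans by blast
qed (use that in blast)

text \<open>
  The order compares the points \<open>x\<close> by the sequences of truth values of \<open>x \<in> G i\<close>,
  lexicographically. Along a set that is monotone for it, every coordinate is eventually constant.
\<close>

lemma cohesive_subset_indexed:
  fixes G :: "'a \<Rightarrow> 'a set"
  assumes "large Y"
  obtains H where "large H" "H \<subseteq> Y" "\<And>i. i \<in> X \<Longrightarrow> small (H \<inter> G i) \<or> small (H - G i)"
proof -
  define L where "L x y \<longleftrightarrow>
    (\<exists>i\<in>X. x \<notin> G i \<and> y \<in> G i \<and> (\<forall>j\<in>X. j \<sqsubset> i \<longrightarrow> (x \<in> G j \<longleftrightarrow> y \<in> G j)))" for x y
  have L_asym: "\<not> L y x" if "L x y" for x y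
    using that less_total unfolding L_def by metis
  obtain H where H: "large H" "H \<subseteq> Y" and hom:
    "(\<forall>x\<in>H. \<forall>y\<in>H. x \<sqsubset> y \<longrightarrow> L x y) \<or> (\<forall>x\<in>H. \<forall>y\<in>H. x \<sqsubset> y \<longrightarrow> \<not> L x y)"
    by (rule ramsey_large[OF assms, of L]) blast+
  have ev: "i \<in> X \<Longrightarrow> \<exists>b\<in>X. \<forall>x\<in>H. \<forall>y\<in>H. b \<sqsubset> x \<longrightarrow> b \<sqsubset> y \<longrightarrow> (x \<in> G i \<longleftrightarrow> y \<in> G i)" for i
  proof (induction i rule: wf_induct_rule[OF wf_less])
    case (1 i)
    then have "\<forall>j\<in>{j\<in>X. j \<sqsubset> i}. \<exists>b. b \<in> X \<and>
        (\<forall>x\<in>H. \<forall>y\<in>H. b \<sqsubset> x \<longrightarrow> b \<sqsubset> y \<longrightarrow> (x \<in> G j \<longleftrightarrow> y \<in> G j))"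
      by blast
    from bchoice[OF this] obtain f where f: "\<And>j. j \<in> {j\<in>X. j \<sqsubset> i} \<Longrightarrow> f j \<in> X"
      "\<And>j x y. j \<in> {j\<in>X. j \<sqsubset> i} \<Longrightarrow> x \<in> H \<Longrightarrow> y \<in> H \<Longrightarrow> f j \<sqsubset> x \<Longrightarrow> f j \<sqsubset> y \<Longrightarrow> (x \<in> G j \<longleftrightarrow> y \<in> G j)"
      by blast
    \<comment> \<open>Regularity enters here: \<open>i\<close> has fewer than \<kappa> predecessors,
      so one \<open>b\<close> lies beyond all the points \<open>f j\<close> after which the earlier
      coordinates no longer change.\<close>
    obtain b where b: "b \<in> X" "\<And>j. j \<in> {j\<in>X. j \<sqsubset> i} \<Longrightarrow> f j \<sqsubset> b"
      using small_image_bounded[OF card_segment[OF 1(2)], of f] f(1) by blast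
    have agree: "x \<in> G j \<longleftrightarrow> y \<in> G j"
      if "j \<in> X" "j \<sqsubset> i" "x \<in> H" "y \<in> H" "b \<sqsubset> x" "b \<sqsubset> y" for j x y
      using f(2)[of j x y] b(2)[of j] that less_trans by blast
    \<comment> \<open>Beyond \<open>b\<close> all coordinates before \<open>i\<close> agree, so a
      difference at \<open>i\<close> is the first one and decides the comparison. Hence coordinate
      \<open>i\<close> can change at most once beyond \<open>b\<close>, upwards if \<open>H\<close>
      is increasing for \<open>L\<close> and downwards otherwise.\<close>
    have up: "L x y" if "x \<in> H" "y \<in> H" "b \<sqsubset> x" "b \<sqsubset> y" "x \<notin> G i" "y \<in> G i" for x y
      unfolding L_def using that agree 1(2) by blast
    show ?case
    proof (rule disjE[OF hom])
      assume inc: "\<forall>x\<in>H. \<forall>y\<in>H. x \<sqsubset> y \<longrightarrow> L x y"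
      show ?thesis
      proof (cases "\<exists>x\<in>H. b \<sqsubset> x \<and> x \<in> G i")
        case True
        then obtain x where x: "x \<in> H" "b \<sqsubset> x" "x \<in> G i" by blast
        then have "y \<in> G i" if "y \<in> H" "x \<sqsubset> y" for y
          using inc up L_asym that less_trans by metis
        then show ?thesis using x H largeD by blast
      qed (use b in blast)
    next
      assume dec: "\<forall>x\<in>H. \<forall>y\<in>H. x \<sqsubset> y \<longrightarrow> \<not> L x y"
      show ?thesis
      proof (cases "\<exists>x\<in>H. b \<sqsubset> x \<and> x \<notin> G i")
        case True
        then obtain x where x: "x \<in> H" "b \<sqsubset> x" "x \<notin> G i" by blast
        then have "y \<notin> G i" if "y \<in> H" "x \<sqsubset> y" for y
          using dec up that less_trans by metis
        then show ?thesis using x H largeD by blast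
      qed (use b in blast)
    qed
  qed
  have "small (H \<inter> G i) \<or> small (H - G i)" if i: "i \<in> X" for i
  proof -
    obtain b where b: "b \<in> X"
      "\<And>x y. x \<in> H \<Longrightarrow> y \<in> H \<Longrightarrow> b \<sqsubset> x \<Longrightarrow> b \<sqsubset> y \<Longrightarrow> (x \<in> G i \<longleftrightarrow> y \<in> G i)"
      using ev[OF i] by blast
    then have "H \<inter> G i \<subseteq> {y \<in> X. y \<sqsubseteq> b} \<or> H - G i \<subseteq> {y \<in> X. y \<sqsubseteq> b}"
      using less_total H(1) largeD by (smt (verit) DiffD1 DiffD2 IntD1 IntD2 mem_Collect_eq subsetI)
    then show ?thesis using small_segment[OF b(1)] small_subset by blast
  qed
  then show thesis using that H by blast
qed

lemma cohesive_subset: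
  fixes G :: "'i \<Rightarrow> 'a set"
  assumes "large Y" "|I| \<le>o |X|"
  obtains H where "large H" "H \<subseteq> Y" "\<And>i. i \<in> I \<Longrightarrow> small (H \<inter> G i) \<or> small (H - G i)"
proof (cases "I = {}")
  case False
  then obtain g where g: "g ` X = I" using card_of_ordLeq2[of I X] assms(2) by auto
  obtain H where H: "large H" "H \<subseteq> Y"
    "\<And>i. i \<in> X \<Longrightarrow> small (H \<inter> G (g i)) \<or> small (H - G (g i))"
    by (rule cohesive_subset_indexed[OF assms(1), of "\<lambda>i. G (g i)"]) (rule that)
  have "small (H \<inter> G i) \<or> small (H - G i)" if "i \<in> I" for i
    using that H(3) unfolding g[symmetric] by (elim imageE) simp
  then show thesis using that H(1,2) by simp
qed (use that[OF assms(1)] in simp)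

section \<open>Order-indiscernible sets\<close>

abbreviation decreasing :: "'a list \<Rightarrow> bool" where "decreasing \<equiv> sorted_wrt (\<lambda>x y. y \<sqsubset> x)"

text \<open>This is the step that lowers the arity. On a cohesive set the value of
  \<open>P p (x # z)\<close> is the same for all but a small set of \<open>x\<close>, hence for all
  \<open>x\<close> beyond a bound depending on \<open>p\<close> and \<open>z\<close>. Lists are
  decreasing so that their head is the largest entry, and sparseness puts it beyond the bounds of
  everything built from smaller entries.\<close>

lemma end_homogeneous_subset:
  fixes P :: "'p \<Rightarrow> 'a list \<Rightarrow> bool"
  assumes "large Y" "small I"
  obtains H P' where "large H" "H \<subseteq> Y"
    "\<And>p x z. p \<in> I \<Longrightarrow> x \<in> H \<Longrightarrow> z \<in> nlists k H \<Longrightarrow> decreasing (x # z) \<Longrightarrow> P p (x # z) \<longleftrightarrow> P' p z"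
proof -
  have "|I| \<le>o |X|" "|nlists k X| \<le>o |X|"
    using assms(2) ordLess_imp_ordLeq card_of_nlists_ordLeq[OF infinite] card_of_mono1 by blast+
  then have "|I \<times> nlists k X| \<le>o |X|" using card_of_Times_ordLeq[OF infinite] by blast
  from cohesive_subset[OF assms(1) this, of "\<lambda>(p, z). {x. P p (x # z)}"]
  obtain H1 where H1: "large H1" "H1 \<subseteq> Y" "\<And>i. i \<in> I \<times> nlists k X \<Longrightarrow>
    small (H1 \<inter> (case i of (p, z) \<Rightarrow> {x. P p (x # z)})) \<or> small (H1 - (case i of (p, z) \<Rightarrow> {x. P p (x # z)}))"
    by blast
  \<comment> \<open>The value that \<open>P p (x # z)\<close> takes for almost all \<open>x\<close>
    in \<open>H1\<close>.\<close>
  define P' where "P' p z \<longleftrightarrow> \<not> small (H1 \<inter> {x. P p (x # z)})" for p z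
  have bd: "\<exists>b\<in>X. \<forall>x\<in>H1. b \<sqsubset> x \<longrightarrow> (P p (x # z) \<longleftrightarrow> P' p z)" if pz: "p \<in> I" "z \<in> nlists k X" for p z
  proof -
    have "small {x \<in> H1. P p (x # z) \<noteq> P' p z}"
    proof (cases "P' p z")
      case True
      then have "small (H1 - {x. P p (x # z)})" using H1(3)[of "(p, z)"] pz by (simp add: P'_def)
      then show ?thesis by (rule small_subset[rotated]) (auto simp: True)
    next
      case False
      then have "small (H1 \<inter> {x. P p (x # z)})" by (simp add: P'_def)
      then show ?thesis by (rule small_subset[rotated]) (auto simp: False)
    qed
    moreover have "{x \<in> H1. P p (x # z) \<noteq> P' p z} \<subseteq> X" using H1(1) by (auto simp: large_def)
    ultimately obtain b where b: "b \<in> X" "\<And>x. x \<in> {x \<in> H1. P p (x # z) \<noteq> P' p z} \<Longrightarrow> x \<sqsubset> b"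
      using small_bounded by blast
    then show ?thesis using less_asym by blast
  qed
  then obtain c where c: "\<And>p z. p \<in> I \<Longrightarrow> z \<in> nlists k X \<Longrightarrow> c p z \<in> X"
    "\<And>p z x. p \<in> I \<Longrightarrow> z \<in> nlists k X \<Longrightarrow> x \<in> H1 \<Longrightarrow> c p z \<sqsubset> x \<Longrightarrow> (P p (x # z) \<longleftrightarrow> P' p z)"
    by metis
  \<comment> \<open>Only a small number of pairs \<open>p\<close>, \<open>z\<close> have all entries
    of \<open>z\<close> at or below \<open>y\<close>, so by regularity one bound serves them
    all.\<close>
  have "\<exists>b\<in>X. \<forall>p\<in>I. \<forall>z\<in>nlists k {w\<in>X. w \<sqsubseteq> y}. c p z \<sqsubset> b" if y: "y \<in> X" for y
  proof -
    have sm: "small (I \<times> nlists k {w\<in>X. w \<sqsubseteq> y})"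
      using small_Times[OF assms(2)] card_of_nlists_ordLess[OF infinite small_segment[OF y]] by blast
    have "nlists k {w\<in>X. w \<sqsubseteq> y} \<subseteq> nlists k X" by (rule nlists_mono) auto
    then have cX: "case_prod c i \<in> X" if "i \<in> I \<times> nlists k {w\<in>X. w \<sqsubseteq> y}" for i
      using that c(1) by (cases i) auto
    obtain b where b: "b \<in> X"
      "\<And>i. i \<in> I \<times> nlists k {w\<in>X. w \<sqsubseteq> y} \<Longrightarrow> case_prod c i \<sqsubset> b"
      using small_image_bounded[of "I \<times> nlists k {w\<in>X. w \<sqsubseteq> y}" "case_prod c", OF sm cX] by auto
    have "c p z \<sqsubset> b" if "p \<in> I" "z \<in> nlists k {w\<in>X. w \<sqsubseteq> y}" for p z
      using b(2)[of "(p, z)"] that by simp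
    then show ?thesis using b(1) by blast
  qed
  then obtain b where b: "\<And>y. y \<in> X \<Longrightarrow> b y \<in> X"
    "\<And>y p z. y \<in> X \<Longrightarrow> p \<in> I \<Longrightarrow> z \<in> nlists k {w\<in>X. w \<sqsubseteq> y} \<Longrightarrow> c p z \<sqsubset> b y"
    by metis
  \<comment> \<open>An arbitrary point that replaces the head of \<open>z\<close> when
    \<open>z\<close> is empty; for this case \<open>H\<close> is taken above
    \<open>b m\<close>.\<close>
  obtain m where m: "m \<in> X" using large_nonempty[OF large_UNIV] by blast
  obtain H where H: "large H" "H \<subseteq> {x \<in> H1. b m \<sqsubset> x}"
    "\<And>x y. x \<in> H \<Longrightarrow> y \<in> H \<Longrightarrow> x \<sqsubset> y \<Longrightarrow> b x \<sqsubset> y"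
    by (rule sparse_subset[OF large_above[OF H1(1) b(1)[OF m]] b(1)]) (assumption, rule that)
  have "P p (x # z) \<longleftrightarrow> P' p z"
    if pxz: "p \<in> I" "x \<in> H" "z \<in> nlists k H" "decreasing (x # z)" for p x z
  proof -
    have zX: "z \<in> nlists k X" using pxz(3) H(1) by (auto simp: nlists_def large_def)
    have "\<exists>y\<in>X. z \<in> nlists k {w\<in>X. w \<sqsubseteq> y} \<and> b y \<sqsubset> x"
    proof (cases z)
      case Nil
      then have "z \<in> nlists k {w\<in>X. w \<sqsubseteq> m}" using pxz(3) by (simp add: nlists_def)
      moreover have "b m \<sqsubset> x" using pxz(2) H(2) by blast
      ultimately show ?thesis using m by blast
    next
      case (Cons y z')
      then have "y \<in> H" "y \<sqsubset> x" using pxz(3,4) by (simp_all add: nlists_def)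
      moreover have "z \<in> nlists k {w\<in>X. w \<sqsubseteq> y}"
        using Cons pxz(4) zX by (auto simp: nlists_def)
      moreover have "b y \<sqsubset> x" using H(3)[OF \<open>y \<in> H\<close> pxz(2) \<open>y \<sqsubset> x\<close>] .
      moreover have "y \<in> X" using largeD[OF H(1) \<open>y \<in> H\<close>] .
      ultimately show ?thesis by blast
    qed
    then have "c p z \<sqsubset> x" using b(2)[OF _ pxz(1)] less_trans by blast
    moreover have "x \<in> H1" using pxz(2) H(2) by blast
    ultimately show ?thesis using c(2)[OF pxz(1) zX] by simp
  qed
  moreover have "H \<subseteq> Y" using H(2) H1(2) by blast
  ultimately show thesis using that[of H P'] H(1) by simp
qed

text \<open>Induction on the length with \<open>P\<close> generalised: once the largest entry is
  irrelevant, the induction hypothesis is applied to the limit predicate \<open>P'\<close> on the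
  tails.\<close>

lemma homogeneous_subset:
  fixes P :: "'p \<Rightarrow> 'a list \<Rightarrow> bool"
  assumes "large Y" "small I"
  shows "\<exists>H. large H \<and> H \<subseteq> Y \<and> (\<forall>p\<in>I. \<forall>z\<in>nlists k H. \<forall>z'\<in>nlists k H.
    decreasing z \<longrightarrow> decreasing z' \<longrightarrow> (P p z \<longleftrightarrow> P p z'))"
  using assms(1)
proof (induction k arbitrary: Y P)
  case 0
  then show ?case by auto
next
  case (Suc k)
  obtain H1 P' where H1: "large H1" "H1 \<subseteq> Y" "\<And>p x z. p \<in> I \<Longrightarrow> x \<in> H1 \<Longrightarrow> z \<in> nlists k H1
      \<Longrightarrow> decreasing (x # z) \<Longrightarrow> P p (x # z) \<longleftrightarrow> P' p z"
    using end_homogeneous_subset[OF Suc.prems assms(2)] by blast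
  obtain H where H: "large H" "H \<subseteq> H1" "\<And>p z z'. p \<in> I \<Longrightarrow> z \<in> nlists k H \<Longrightarrow> z' \<in> nlists k H
      \<Longrightarrow> decreasing z \<Longrightarrow> decreasing z' \<Longrightarrow> (P' p z \<longleftrightarrow> P' p z')"
    using Suc.IH[OF H1(1), of P'] by blast
  have tl: "(P p z \<longleftrightarrow> P' p (tl z)) \<and> tl z \<in> nlists k H \<and> decreasing (tl z)"
    if pz: "p \<in> I" "z \<in> nlists (Suc k) H" "decreasing z" for p z
  proof -
    obtain x z' where "z = x # z'" "x \<in> H" "z' \<in> nlists k H"
      using pz(2) by (auto simp: in_nlists_Suc_iff)
    then show ?thesis
      using pz(3) H1(3)[OF pz(1), of x z'] H(2) nlists_mono[OF H(2), of k] by auto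
  qed
  have "P p z \<longleftrightarrow> P p z'" if "p \<in> I" "z \<in> nlists (Suc k) H" "z' \<in> nlists (Suc k) H"
    "decreasing z" "decreasing z'" for p z z'
    using tl[of p z] tl[of p z'] H(3)[of p "tl z" "tl z'"] that by simp
  moreover have "H \<subseteq> Y" using H(2) H1(2) by (rule subset_trans)
  ultimately show ?case using H(1) by blast
qed

text \<open>All lengths up to the bound are treated at once because a tuple with repeated entries
  has fewer distinct points than its arity.\<close>

lemma homogeneous_subset_upto:
  fixes P :: "'p \<Rightarrow> 'a list \<Rightarrow> bool"
  assumes "large Y" "small I"
  shows "\<exists>H. large H \<and> H \<subseteq> Y \<and> (\<forall>k\<le>n. \<forall>p\<in>I. \<forall>z\<in>nlists k H. \<forall>z'\<in>nlists k H.
    decreasing z \<longrightarrow> decreasing z' \<longrightarrow> (P p z \<longleftrightarrow> P p z'))"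
proof (induction n)
  case 0
  then show ?case using homogeneous_subset[OF assms, of 0] by auto
next
  case (Suc n)
  then obtain H1 where H1: "large H1" "H1 \<subseteq> Y" "\<forall>k\<le>n. \<forall>p\<in>I. \<forall>z\<in>nlists k H1. \<forall>z'\<in>nlists k H1.
    decreasing z \<longrightarrow> decreasing z' \<longrightarrow> (P p z \<longleftrightarrow> P p z')" by blast
  obtain H where H: "large H" "H \<subseteq> H1" "\<forall>p\<in>I. \<forall>z\<in>nlists (Suc n) H. \<forall>z'\<in>nlists (Suc n) H.
    decreasing z \<longrightarrow> decreasing z' \<longrightarrow> (P p z \<longleftrightarrow> P p z')"
    using homogeneous_subset[OF H1(1) assms(2), of "Suc n" P] by auto
  have "P p z \<longleftrightarrow> P p z'" if "k \<le> Suc n" "p \<in> I" "z \<in> nlists k H" "z' \<in> nlists k H"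
    "decreasing z" "decreasing z'" for k p z z'
  proof (cases "k = Suc n")
    case True
    then show ?thesis using H(3)[rule_format, of p z z'] that by simp
  next
    case False
    moreover have "z \<in> nlists k H1" "z' \<in> nlists k H1" using that nlists_mono[OF H(2)] by auto
    ultimately show ?thesis using H1(3)[rule_format, of k p z z'] that by simp
  qed
  moreover have "H \<subseteq> Y" using H(2) H1(2) by (rule subset_trans)
  ultimately show ?case using H(1) by blast
qed

lemma decreasing_enumeration:
  assumes "finite S" "S \<subseteq> X"
  shows "\<exists>z. set z = S \<and> decreasing z"
  using assms
proof (induction "card S" arbitrary: S)
  case 0
  then show ?case by (intro exI[of _ "[]"]) auto
next
  case (Suc n)
  then obtain s where "s \<in> S" by fastforce
  then obtain m where m: "m \<in> S" "\<And>y. y \<sqsubset> m \<Longrightarrow> y \<notin> S"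
    using wfE_min[OF wf_less, of s S] by auto
  then obtain z where z: "set z = S - {m}" "decreasing z"
    using Suc.hyps(1)[of "S - {m}"] Suc.hyps(2)[symmetric] Suc.prems
    by (auto simp: card_Diff_singleton)
  have "\<forall>y\<in>S - {m}. m \<sqsubset> y" using m Suc.prems(2) less_total by blast
  then have "decreasing (z @ [m])" using z by (simp add: sorted_wrt_append)
  then show ?case using z m by (intro exI[of _ "z @ [m]"]) auto
qed

lemma decreasing_distinct: "decreasing z \<Longrightarrow> distinct z"
  by (induction z) (auto simp: less_irrefl)

definition order_charts :: "'a set \<Rightarrow> ('a \<rightharpoonup> 'a) set" where
  "order_charts H = {f. dom f \<subseteq> H \<and> ran f \<subseteq> H \<and>
    (\<forall>x\<in>dom f. \<forall>y\<in>dom f. x \<sqsubset> y \<longrightarrow> the (f x) \<sqsubset> the (f y))}"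

text \<open>A tuple is determined by the decreasing list \<open>z\<close> of its distinct entries
  and the pattern \<open>\<sigma>\<close> of their positions. For a fixed relation and pattern,
  membership is a property of \<open>z\<close> alone, and there are fewer than \<kappa> such
  parameters. An order-preserving chart turns \<open>z\<close> into another decreasing list over
  \<open>H\<close> and keeps the pattern, so homogeneity applies.\<close>

lemma order_charts_subset_pAut:
  fixes Rs :: "'a list set set"
  assumes "small Rs" "bdd_above (ar ` Rs)"
  obtains H where "large H" "order_charts H \<subseteq> pAut X Rs ar"
proof -
  obtain N where N: "\<And>R. R \<in> Rs \<Longrightarrow> ar R \<le> N"
    using assms(2) unfolding bdd_above_def by blast
  \<comment> \<open>Bounded arities leave only finitely many patterns.\<close>
  define W where "W = {\<sigma>. set \<sigma> \<subseteq> {..<N} \<and> length \<sigma> \<le> N}"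
  have "small (Rs \<times> W)" unfolding W_def
    using small_Times assms(1) small_finite finite_lists_length_le[of "{..<N}"] by blast
  then obtain H where H: "large H" and
    hom: "\<And>k p z z'. k \<le> N \<Longrightarrow> p \<in> Rs \<times> W \<Longrightarrow> z \<in> nlists k H \<Longrightarrow> z' \<in> nlists k H \<Longrightarrow>
      decreasing z \<Longrightarrow> decreasing z' \<Longrightarrow> (map ((!) z) (snd p) \<in> fst p \<longleftrightarrow> map ((!) z') (snd p) \<in> fst p)"
    using homogeneous_subset_upto[OF large_UNIV, of "Rs \<times> W" N "\<lambda>p z. map ((!) z) (snd p) \<in> fst p"]
    by blast
  have "f \<in> pAut X Rs ar" if f: "f \<in> order_charts H" for f
  proof -
    have HX: "H \<subseteq> X" using H by (simp add: large_def)
    have mono: "the (f x) \<sqsubset> the (f y)" if "x \<in> dom f" "y \<in> dom f" "x \<sqsubset> y" for x y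
      using f that by (auto simp: order_charts_def)
    have dom: "dom f \<subseteq> H" and ran: "ran f \<subseteq> H" using f by (auto simp: order_charts_def)
    have f_in: "the (f x) \<in> H" if "x \<in> dom f" for x using that ran by (auto simp: ran_def)
    have "inj_on f (dom f)"
    proof (rule inj_onI, rule ccontr)
      fix x y assume xy: "x \<in> dom f" "y \<in> dom f" "f x = f y" "x \<noteq> y"
      then have "x \<sqsubset> y \<or> y \<sqsubset> x" using less_total dom HX by blast
      then show False using mono[of x y] mono[of y x] xy less_irrefl by auto
    qed
    then have "f \<in> sym_inv_monoid X" using dom ran HX by (auto simp: sym_inv_monoid_def)
    moreover have "map (\<lambda>a. the (f a)) \<alpha> \<in> R \<longleftrightarrow> \<alpha> \<in> R"
      if R: "R \<in> Rs" and \<alpha>: "\<alpha> \<in> nlists (ar R) (dom f)" for R \<alpha>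
    proof -
      have set\<alpha>: "set \<alpha> \<subseteq> dom f" "length \<alpha> = ar R" using \<alpha> by (auto simp: nlists_def)
      obtain z where z: "set z = set \<alpha>" "decreasing z"
        using decreasing_enumeration[of "set \<alpha>"] set\<alpha>(1) dom HX by auto
      have "length z = card (set \<alpha>)" using decreasing_distinct z distinct_card by metis
      also have "\<dots> \<le> N" using card_length[of \<alpha>] N[OF R] set\<alpha>(2) by simp
      finally have lz: "length z \<le> N" .
      have "\<forall>a\<in>set \<alpha>. \<exists>i<length z. z ! i = a" using z(1) by (metis in_set_conv_nth)
      then obtain idx where idx: "\<And>a. a \<in> set \<alpha> \<Longrightarrow> idx a < length z \<and> z ! idx a = a" by metis
      define \<sigma> where "\<sigma> = map idx \<alpha>"
      have "\<sigma> \<in> W" using idx lz N[OF R] set\<alpha>(2) by (force simp: W_def \<sigma>_def)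
      have \<alpha>_eq: "\<alpha> = map ((!) z) \<sigma>" using idx by (simp add: \<sigma>_def map_idI)
      have f\<alpha>_eq: "map (\<lambda>a. the (f a)) \<alpha> = map ((!) (map (\<lambda>a. the (f a)) z)) \<sigma>"
        using idx by (simp add: \<sigma>_def)
      have "decreasing (map (\<lambda>a. the (f a)) z)"
        unfolding sorted_wrt_map using z set\<alpha>(1) mono
        by (intro sorted_wrt_mono_rel[OF _ z(2)]) (simp add: subsetD)
      moreover have "\<forall>a\<in>set \<alpha>. a \<in> H \<and> the (f a) \<in> H" using f_in set\<alpha>(1) dom by blast
      then have "z \<in> nlists (length z) H" "map (\<lambda>a. the (f a)) z \<in> nlists (length z) H"
        using z(1) by (auto simp: nlists_def)
      ultimately show ?thesis
        using hom[OF lz, of "(R, \<sigma>)" z "map (\<lambda>a. the (f a)) z"] R \<open>\<sigma> \<in> W\<close> z(2)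
        unfolding f\<alpha>_eq unfolding \<alpha>_eq by simp
    qed
    ultimately show ?thesis by (simp add: pAut_def)
  qed
  then show thesis using that H by blast
qed

end

section \<open>Charts given by parametrisations\<close>

text \<open>For \<open>a\<close> injective on \<open>P\<close> this is the inverse of
  \<open>a\<close> followed by \<open>c\<close>. Describing charts by a common parameter set lets
  products be computed by cancelling the middle parametrisation.\<close>

definition chart :: "'i set \<Rightarrow> ('i \<Rightarrow> 'a) \<Rightarrow> ('i \<Rightarrow> 'a) \<Rightarrow> 'a \<rightharpoonup> 'a" where
  "chart P a c x = (if x \<in> a ` P then Some (c (inv_into P a x)) else None)"

lemma chart_apply: "inj_on a P \<Longrightarrow> p \<in> P \<Longrightarrow> chart P a c (a p) = Some (c p)"
  by (simp add: chart_def)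

lemma dom_chart: "dom (chart P a c) = a ` P"
  by (auto simp: chart_def dom_def)

lemma chart_eqI:
  assumes "inj_on a P" "\<And>x. x \<notin> a ` P \<Longrightarrow> f x = None" "\<And>p. p \<in> P \<Longrightarrow> f (a p) = Some (c p)"
  shows "f = chart P a c"
proof
  fix x show "f x = chart P a c x"
    using assms by (cases "x \<in> a ` P") (auto simp: chart_apply, simp add: chart_def)
qed

lemma chart_in_sym_inv_monoid:
  assumes "inj_on a P" "inj_on c P" "a ` P \<subseteq> X" "c ` P \<subseteq> X"
  shows "chart P a c \<in> sym_inv_monoid X"
proof -
  have "ran (chart P a c) \<subseteq> c ` P"
    by (auto simp: chart_def ran_def inv_into_into)
  moreover have "inj_on (chart P a c) (a ` P)"
    using assms(1,2) by (auto simp: inj_on_def chart_apply[OF assms(1)])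
  ultimately show ?thesis using assms(3,4) by (auto simp: sym_inv_monoid_def dom_chart)
qed

lemma sym_inv_monoid_chart:
  assumes "f \<in> sym_inv_monoid X"
  shows "f = chart (dom f) id (\<lambda>x. the (f x))" "inj_on (\<lambda>x. the (f x)) (dom f)"
    "dom f \<subseteq> X" "(\<lambda>x. the (f x)) ` dom f \<subseteq> X"
proof -
  have f: "dom f \<subseteq> X" "ran f \<subseteq> X" "inj_on f (dom f)"
    using assms by (auto simp: sym_inv_monoid_def)
  show "f = chart (dom f) id (\<lambda>x. the (f x))" by (rule chart_eqI) auto
  show "inj_on (\<lambda>x. the (f x)) (dom f)"
  proof (rule inj_onI)
    fix x y assume "x \<in> dom f" "y \<in> dom f" "the (f x) = the (f y)"
    then have "f x = f y" by auto
    then show "x = y" using inj_onD[OF f(3)] \<open>x \<in> dom f\<close> \<open>y \<in> dom f\<close> by blast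
  qed
  show "dom f \<subseteq> X" by fact
  show "(\<lambda>x. the (f x)) ` dom f \<subseteq> X" using f(2) by (auto simp: ran_def)
qed

text \<open>The map \<open>k\<close> places the parameters of one factor among those of the other.
  This form and the next serve for multiplication by a fixed chart whose domain or range is larger
  than needed.\<close>

lemma chart_mult_right:
  assumes "inj_on a P" "inj_on b Q" "k ` P \<subseteq> Q"
  shows "chart P a (\<lambda>p. b (k p)) \<cdot>\<^sub>c chart Q b c = chart P a (\<lambda>p. c (k p))"
proof (rule chart_eqI[OF assms(1)])
  show "(chart P a (\<lambda>p. b (k p)) \<cdot>\<^sub>c chart Q b c) x = None" if "x \<notin> a ` P" for x
    using that by (simp add: chart_mult_def map_comp_def chart_def)
  show "(chart P a (\<lambda>p. b (k p)) \<cdot>\<^sub>c chart Q b c) (a p) = Some (c (k p))" if "p \<in> P" for p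
    using that assms by (simp add: chart_mult_def map_comp_def chart_apply image_subset_iff)
qed

lemma chart_mult_left:
  assumes "inj_on a Q" "inj_on b Q" "k ` P \<subseteq> Q" "inj_on k P"
  shows "chart Q a b \<cdot>\<^sub>c chart P (\<lambda>p. b (k p)) c = chart P (\<lambda>p. a (k p)) c"
proof (rule chart_eqI)
  have inj: "inj_on (\<lambda>p. b (k p)) P"
    using comp_inj_on[OF assms(4) inj_on_subset[OF assms(2,3)]] by (simp add: comp_def)
  show "inj_on (\<lambda>p. a (k p)) P"
    using comp_inj_on[OF assms(4) inj_on_subset[OF assms(1,3)]] by (simp add: comp_def)
  show "(chart Q a b \<cdot>\<^sub>c chart P (\<lambda>p. b (k p)) c) (a (k p)) = Some (c p)" if "p \<in> P" for p
    using that assms(1,3) chart_apply[OF inj that, of c]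
    by (simp add: chart_mult_def map_comp_def chart_apply image_subset_iff)
  show "(chart Q a b \<cdot>\<^sub>c chart P (\<lambda>p. b (k p)) c) x = None" if "x \<notin> (\<lambda>p. a (k p)) ` P" for x
  proof (cases "x \<in> a ` Q")
    case True
    then obtain q where q: "q \<in> Q" "x = a q" by blast
    \<comment> \<open>Injectivity of \<open>b\<close> ensures that a parameter outside the image of
      \<open>k\<close> drops out of the product.\<close>
    then have "b q \<notin> (\<lambda>p. b (k p)) ` P"
      using that assms(2,3) by (auto simp: inj_on_def image_subset_iff)
    then show ?thesis
      using q assms(1) by (simp add: chart_mult_def map_comp_def chart_apply) (simp add: chart_def)
  qed (simp add: chart_mult_def map_comp_def chart_def)
qed

lemma chart_mult:
  "inj_on a P \<Longrightarrow> inj_on b P \<Longrightarrow> chart P a b \<cdot>\<^sub>c chart P b c = chart P a c"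
  using chart_mult_right[of a P b P "\<lambda>p. p" c] by simp

section \<open>Generating the symmetric inverse monoid\<close>

context ramsey_order
begin

lemma chart_in_order_charts:
  assumes "inj_on a P" "a ` P \<subseteq> H" "c ` P \<subseteq> H"
    and "\<And>p q. p \<in> P \<Longrightarrow> q \<in> P \<Longrightarrow> a p \<sqsubset> a q \<Longrightarrow> c p \<sqsubset> c q"
  shows "chart P a c \<in> order_charts H"
proof -
  have "ran (chart P a c) \<subseteq> c ` P"
    by (auto simp: chart_def ran_def inv_into_into)
  moreover have "the (chart P a c x) \<sqsubset> the (chart P a c y)"
    if "x \<in> a ` P" "y \<in> a ` P" "x \<sqsubset> y" for x y
    using that assms(1,4) by (auto simp: chart_apply)
  ultimately show ?thesis using assms(2,3) by (auto simp: order_charts_def dom_chart)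
qed

section \<open>Embedding well-orders into large sets\<close>

abbreviation less_rel :: "('a \<times> 'a) set" where "less_rel \<equiv> {(x, y). x \<sqsubset> y}"

definition embeds :: "('t \<times> 't) set \<Rightarrow> 't set \<Rightarrow> ('t \<Rightarrow> 'a) \<Rightarrow> 'a set \<Rightarrow> bool" where
  "embeds R T z H \<longleftrightarrow> z ` T \<subseteq> H \<and> inj_on z T \<and> (\<forall>s\<in>T. \<forall>t\<in>T. z s \<sqsubset> z t \<longleftrightarrow> (s, t) \<in> R)"

lemma embedsD:
  assumes "embeds R T z H"
  shows "t \<in> T \<Longrightarrow> z t \<in> H" "inj_on z T" "s \<in> T \<Longrightarrow> t \<in> T \<Longrightarrow> z s \<sqsubset> z t \<longleftrightarrow> (s, t) \<in> R"
  using assms unfolding embeds_def by blast+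

text \<open>Recursion along \<open>R\<close>: the values already chosen below \<open>t\<close> form
  a small set, which is bounded by regularity, and the unbounded set \<open>H\<close> has a point
  beyond the bound. Totality of \<open>R\<close> then gives injectivity and reflection of the
  order.\<close>

lemma embedding_exists:
  fixes R :: "('t \<times> 't) set"
  assumes "large H" "wf R" "\<And>t. t \<in> T \<Longrightarrow> small {s \<in> T. (s, t) \<in> R}"
    and total: "\<And>s t. s \<in> T \<Longrightarrow> t \<in> T \<Longrightarrow> s \<noteq> t \<Longrightarrow> (s, t) \<in> R \<or> (t, s) \<in> R"
  shows "\<exists>z. embeds R T z H"
proof -
  have "\<exists>z. \<forall>t. t \<in> T \<longrightarrow> z t \<in> H \<and> (\<forall>s\<in>T. (s, t) \<in> R \<longrightarrow> z s \<sqsubset> z t)"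
  proof (rule dependent_wf_choice[OF assms(2),
      where P = "\<lambda>z t b. t \<in> T \<longrightarrow> b \<in> H \<and> (\<forall>s\<in>T. (s, t) \<in> R \<longrightarrow> z s \<sqsubset> b)"])
    fix t :: 't and z :: "'t \<Rightarrow> 'a"
    assume IH: "\<And>s. (s, t) \<in> R \<Longrightarrow> s \<in> T \<longrightarrow> z s \<in> H \<and> (\<forall>r\<in>T. (r, s) \<in> R \<longrightarrow> z r \<sqsubset> z s)"
    show "\<exists>b. t \<in> T \<longrightarrow> b \<in> H \<and> (\<forall>s\<in>T. (s, t) \<in> R \<longrightarrow> z s \<sqsubset> b)"
    proof (cases "t \<in> T")
      case True
      have "z s \<in> X" if "s \<in> {s \<in> T. (s, t) \<in> R}" for s
        using IH[of s] that largeD[OF assms(1)] by simp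
      from small_image_bounded[of "{s \<in> T. (s, t) \<in> R}" z, OF assms(3)[OF True] this]
      obtain b0 where b0: "b0 \<in> X" "\<forall>s\<in>{s \<in> T. (s, t) \<in> R}. z s \<sqsubset> b0" by auto
      obtain b where b: "b \<in> H" "b0 \<sqsubset> b" using large_unbounded[OF assms(1) b0(1)] by auto
      have "z s \<sqsubset> b" if "s \<in> T" "(s, t) \<in> R" for s
        using b0(2) that less_trans[OF _ b(2)] by simp
      then show ?thesis using b(1) by blast
    qed simp
  qed auto
  then obtain z where z: "\<And>t. t \<in> T \<Longrightarrow> z t \<in> H"
    "\<And>s t. s \<in> T \<Longrightarrow> t \<in> T \<Longrightarrow> (s, t) \<in> R \<Longrightarrow> z s \<sqsubset> z t" by blast
  have ne: "z s \<noteq> z t" if "s \<in> T" "t \<in> T" "s \<noteq> t" for s t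
    using total[OF that] z(2)[of s t] z(2)[of t s] that less_irrefl by metis
  have "z s \<sqsubset> z t \<longleftrightarrow> (s, t) \<in> R" if st: "s \<in> T" "t \<in> T" for s t
  proof
    assume lt: "z s \<sqsubset> z t"
    then have "s \<noteq> t" using less_irrefl by metis
    then show "(s, t) \<in> R" using total[OF st] z(2)[OF st(2,1)] less_asym[OF lt] by blast
  qed (rule z(2)[OF st])
  then show ?thesis using ne z(1) by (intro exI[of _ z]) (auto simp: embeds_def inj_on_def)
qed

lemma embedding_exists_less:
  assumes "large H"
  shows "\<exists>z. embeds less_rel X z H"
  by (rule embedding_exists[OF assms wf_less]) (use card_segment less_total in auto)

abbreviation bool_lex :: "(('a \<times> bool) \<times> 'a \<times> bool) set" where
  "bool_lex \<equiv> less_rel <*lex*> {(False, True)}"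

text \<open>Each point of \<open>X\<close> is doubled, its \<open>False\<close> copy immediately
  before its \<open>True\<close> copy. Initial segments stay small since they lie over a segment of
  \<open>X\<close>.\<close>

lemma embedding_exists_bool_lex:
  assumes "large H"
  shows "\<exists>z. embeds bool_lex (X \<times> UNIV) z H"
proof (rule embedding_exists[OF assms])
  show "wf bool_lex" by (intro wf_lex_prod wf_less) (auto intro: wf_insert[THEN iffD2])
  show "small {s \<in> X \<times> UNIV. (s, t) \<in> bool_lex}" if "t \<in> X \<times> UNIV" for t
  proof (rule small_subset)
    show "small ({y \<in> X. y \<sqsubseteq> fst t} \<times> (UNIV :: bool set))"
      using that by (intro small_Times small_segment small_finite) auto
    show "{s \<in> X \<times> UNIV. (s, t) \<in> bool_lex} \<subseteq> {y \<in> X. y \<sqsubseteq> fst t} \<times> UNIV"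
      by (cases t) auto
  qed
  show "(s, t) \<in> bool_lex \<or> (t, s) \<in> bool_lex" if "s \<in> X \<times> UNIV" "t \<in> X \<times> UNIV" "s \<noteq> t" for s t
    using that less_total[of "fst s" "fst t"] by (cases s; cases t) auto
qed

text \<open>Bounding \<open>x\<close> and \<open>y\<close> by \<open>v\<close> keeps initial
  segments of the lexicographic order small; in the full cube, all triples with a smaller first
  entry would form a large segment. The bound is symmetric in \<open>x\<close> and \<open>y\<close>,
  so the set is closed under the swap.\<close>

definition triples :: "('a \<times> 'a \<times> 'a) set" where
  "triples = {(v, x, y). v \<in> X \<and> x \<in> X \<and> y \<in> X \<and> x \<sqsubseteq> v \<and> y \<sqsubseteq> v}"

abbreviation triple_lex :: "(('a \<times> 'a \<times> 'a) \<times> 'a \<times> 'a \<times> 'a) set" where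
  "triple_lex \<equiv> less_rel <*lex*> less_rel <*lex*> less_rel"

lemma embedding_exists_triple_lex:
  assumes "large H"
  shows "\<exists>z. embeds triple_lex triples z H"
proof (rule embedding_exists[OF assms])
  show "wf triple_lex" by (intro wf_lex_prod wf_less)
  show "small {s \<in> triples. (s, t) \<in> triple_lex}" if "t \<in> triples" for t
  proof (rule small_subset)
    let ?S = "{y \<in> X. y \<sqsubseteq> fst t}"
    show "small (?S \<times> ?S \<times> ?S)"
      using that by (intro small_Times small_segment) (auto simp: triples_def)
    show "{s \<in> triples. (s, t) \<in> triple_lex} \<subseteq> ?S \<times> ?S \<times> ?S"
      by (cases t) (auto simp: triples_def intro: less_trans)
  qed
  show "(s, t) \<in> triple_lex \<or> (t, s) \<in> triple_lex" if "s \<in> triples" "t \<in> triples" "s \<noteq> t" for s t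
  proof -
    obtain v x y v' x' y' where [simp]: "s = (v, x, y)" "t = (v', x', y')" by (cases s, cases t) auto
    show ?thesis
      using that less_total[of v v'] less_total[of x x'] less_total[of y y']
      by (auto simp: triples_def)
  qed
qed

lemma swap_triples: "(v, x, y) \<in> triples \<longleftrightarrow> (v, y, x) \<in> triples"
  by (auto simp: triples_def)

definition swap_chart :: "('a \<times> 'a \<times> 'a \<Rightarrow> 'a) \<Rightarrow> 'a \<rightharpoonup> 'a" where
  "swap_chart z = chart triples z (\<lambda>(v, x, y). z (v, y, x))"

text \<open>The least cut at or above a point serves as the name of its block; it exists because
  large sets are unbounded.\<close>

lemma least_above:
  assumes "large C" "x \<in> X"
  shows "\<exists>h\<in>C. x \<sqsubseteq> h \<and> (\<forall>h'\<in>C. x \<sqsubseteq> h' \<longrightarrow> h \<sqsubseteq> h')"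
proof -
  obtain h0 where h0: "h0 \<in> {h \<in> C. x \<sqsubseteq> h}" using large_unbounded[OF assms] by auto
  obtain h where h: "h \<in> {h \<in> C. x \<sqsubseteq> h}" "\<And>y. (y, h) \<in> less_rel \<Longrightarrow> y \<notin> {h \<in> C. x \<sqsubseteq> h}"
    using wfE_min[OF wf_less h0] by auto
  have "h \<sqsubseteq> h'" if "h' \<in> C" "x \<sqsubseteq> h'" for h'
    using h(2)[of h'] that not_less_iff[of h' h] h(1) largeD[OF assms(1)] by auto
  then show ?thesis using h(1) by auto
qed

lemma sgen_mult_eq: "f \<in> sgen V \<Longrightarrow> g \<in> sgen V \<Longrightarrow> f \<cdot>\<^sub>c g = h \<Longrightarrow> h \<in> sgen V"
  using sgen.mult by metis

text \<open>
  With \<open>\<nu> p\<close> the block of \<open>a p\<close> and \<open>c p\<close>, the triple \<open>(\<nu> p, a p, c p)\<close> increases with \<open>a p\<close>, and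
  after the swap it increases with \<open>c p\<close>.
\<close>

lemma block_preserving_in_sgen:
  fixes a c :: "'i \<Rightarrow> 'a"
  assumes \<theta>: "embeds less_rel X \<theta> H" and z: "embeds triple_lex triples z H"
    and V: "order_charts H \<subseteq> V" "chart X id \<theta> \<in> V" "chart X \<theta> id \<in> V" "swap_chart z \<in> V"
    and a: "inj_on a P" "a ` P \<subseteq> X" and c: "inj_on c P" "c ` P \<subseteq> X"
    and "large C" and cut: "\<And>p h. p \<in> P \<Longrightarrow> h \<in> C \<Longrightarrow> a p \<sqsubseteq> h \<longleftrightarrow> c p \<sqsubseteq> h"
  shows "chart P a c \<in> sgen V"
proof -
  have aX: "a p \<in> X" and cX: "c p \<in> X" if "p \<in> P" for p using that a c by auto
  \<comment> \<open>The block is chosen from \<open>a p\<close>, but by \<open>cut\<close> the same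
    point is also the least cut at or above \<open>c p\<close>.\<close>
  have "\<forall>p\<in>P. \<exists>h. h \<in> C \<and> a p \<sqsubseteq> h \<and> (\<forall>h'\<in>C. a p \<sqsubseteq> h' \<longrightarrow> h \<sqsubseteq> h')"
    using least_above[OF \<open>large C\<close> aX] by blast
  from bchoice[OF this] obtain \<nu> where \<nu>: "\<And>p. p \<in> P \<Longrightarrow> \<nu> p \<in> C" "\<And>p. p \<in> P \<Longrightarrow> a p \<sqsubseteq> \<nu> p"
    "\<And>p h. p \<in> P \<Longrightarrow> h \<in> C \<Longrightarrow> a p \<sqsubseteq> h \<Longrightarrow> \<nu> p \<sqsubseteq> h" by blast
  have \<nu>X: "\<nu> p \<in> X" if "p \<in> P" for p using \<nu>(1)[OF that] largeD[OF \<open>large C\<close>] by simp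
  have \<nu>c: "c p \<sqsubseteq> \<nu> p" if "p \<in> P" for p using cut[OF that \<nu>(1)[OF that]] \<nu>(2)[OF that] by simp
  have mono_a: "\<nu> p \<sqsubseteq> \<nu> q" if "p \<in> P" "q \<in> P" "a p \<sqsubset> a q" for p q
    using \<nu>(3)[OF that(1) \<nu>(1)[OF that(2)]] \<nu>(2)[OF that(2)] that(3) less_trans by metis
  \<comment> \<open>Minimality of \<open>\<nu> p\<close> refers to \<open>a p\<close>, so the bound
    on \<open>c p\<close> is first carried over by \<open>cut\<close>.\<close>
  have mono_c: "\<nu> p \<sqsubseteq> \<nu> q" if "p \<in> P" "q \<in> P" "c p \<sqsubset> c q" for p q
  proof (rule \<nu>(3)[OF that(1) \<nu>(1)[OF that(2)]])
    have "c p \<sqsubseteq> \<nu> q" using \<nu>c[OF that(2)] that(3) less_trans by metis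
    then show "a p \<sqsubseteq> \<nu> q" using cut[OF that(1) \<nu>(1)[OF that(2)]] by simp
  qed
  define s where "s p = (\<nu> p, a p, c p)" for p
  define s' where "s' p = (\<nu> p, c p, a p)" for p
  have s: "s p \<in> triples" and s': "s' p \<in> triples" if "p \<in> P" for p
    using that aX cX \<nu>X \<nu>(2) \<nu>c by (simp_all add: s_def s'_def triples_def)
  have inj_s': "inj_on s' P" using a(1) by (auto simp: inj_on_def s'_def)
  have inj_zs': "inj_on (\<lambda>p. z (s' p)) P"
    using comp_inj_on[OF inj_s' inj_on_subset[OF embedsD(2)[OF z]]] s' by (auto simp: comp_def)
  have inj_\<theta>a: "inj_on (\<lambda>p. \<theta> (a p)) P"
    using comp_inj_on[OF a(1) inj_on_subset[OF embedsD(2)[OF \<theta>] a(2)]] by (simp add: comp_def)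
  have "chart P (\<lambda>p. \<theta> (a p)) (\<lambda>p. z (s p)) \<in> order_charts H"
  proof (rule chart_in_order_charts[OF inj_\<theta>a])
    fix p q assume pq: "p \<in> P" "q \<in> P" "\<theta> (a p) \<sqsubset> \<theta> (a q)"
    then have "a p \<sqsubset> a q" using embedsD(3)[OF \<theta> aX aX] by simp
    then have "(s p, s q) \<in> triple_lex" using mono_a[OF pq(1,2)] by (auto simp: s_def)
    then show "z (s p) \<sqsubset> z (s q)" using embedsD(3)[OF z s s] pq by simp
  qed (use embedsD(1)[OF \<theta> aX] embedsD(1)[OF z s] in auto)
  then have g1: "chart P (\<lambda>p. \<theta> (a p)) (\<lambda>p. z (s p)) \<in> sgen V" using V(1) by (auto intro: sgen.base)
  have "chart P (\<lambda>p. z (s' p)) (\<lambda>p. \<theta> (c p)) \<in> order_charts H"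
  proof (rule chart_in_order_charts[OF inj_zs'])
    fix p q assume pq: "p \<in> P" "q \<in> P" "z (s' p) \<sqsubset> z (s' q)"
    then have lex: "(s' p, s' q) \<in> triple_lex" using embedsD(3)[OF z s' s'] by simp
    then have "p \<noteq> q" using less_irrefl by (auto simp: s'_def)
    then have "c p \<noteq> c q" using pq c(1) by (auto simp: inj_on_def)
    moreover have "\<not> c q \<sqsubset> c p"
      using lex mono_c[OF pq(2,1)] less_asym less_irrefl by (auto simp: s'_def)
    ultimately have "c p \<sqsubset> c q" using less_total[OF cX cX] pq by auto
    then show "\<theta> (c p) \<sqsubset> \<theta> (c q)" using embedsD(3)[OF \<theta> cX cX] pq by simp
  qed (use embedsD(1)[OF \<theta> cX] embedsD(1)[OF z s'] in auto)
  then have g2: "chart P (\<lambda>p. z (s' p)) (\<lambda>p. \<theta> (c p)) \<in> sgen V" using V(1) by (auto intro: sgen.base)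
  \<comment> \<open>Order charts act only inside \<open>H\<close>, so the fixed chart given by
    \<open>\<theta>\<close> first moves \<open>X\<close> into \<open>H\<close>; its inverse moves
    the result back at the end.\<close>
  have "chart P a (\<lambda>p. z (s p)) \<in> sgen V"
    using chart_mult_left[OF _ embedsD(2)[OF \<theta>] a(2,1), of id "\<lambda>p. z (s p)"]
    by (intro sgen_mult_eq[OF sgen.base[OF V(2)] g1]) simp
  moreover have "chart P a (\<lambda>p. z (s p)) \<cdot>\<^sub>c swap_chart z = chart P a (\<lambda>p. z (s' p))"
  proof -
    have "s ` P \<subseteq> triples" using s by (rule image_subsetI)
    from chart_mult_right[OF a(1) embedsD(2)[OF z] this, of "\<lambda>(v, x, y). z (v, y, x)"]
    show ?thesis unfolding swap_chart_def s_def s'_def by simp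
  qed
  ultimately have "chart P a (\<lambda>p. z (s' p)) \<in> sgen V"
    by (rule sgen_mult_eq[OF _ sgen.base[OF V(4)]])
  then have "chart P a (\<lambda>p. \<theta> (c p)) \<in> sgen V"
    by (rule sgen_mult_eq[OF _ g2 chart_mult[OF a(1) inj_zs']])
  moreover have "chart P a (\<lambda>p. \<theta> (c p)) \<cdot>\<^sub>c chart X \<theta> id = chart P a c"
    using chart_mult_right[OF a(1) embedsD(2)[OF \<theta>] c(2), of id] by simp
  ultimately show ?thesis by (rule sgen_mult_eq[OF _ sgen.base[OF V(3)]])
qed

lemma large_image: "inj_on g A \<Longrightarrow> large A \<Longrightarrow> g ` A \<subseteq> X \<Longrightarrow> large (g ` A)"
proof -
  assume inj: "inj_on g A" and A: "large A" and X: "g ` A \<subseteq> X"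
  have "|A| =o |g ` A|" using inj card_of_ordIso inj_on_imp_bij_betw by blast
  then have "|g ` A| =o |X|"
    using A ordIso_transitive[OF ordIso_symmetric] by (auto simp: large_def)
  then show "large (g ` A)" using X by (simp add: large_def)
qed

text \<open>The two copies of \<open>X\<close> in an embedding of the doubled order into
  \<open>C\<close> have disjoint large images.\<close>

lemma large_split:
  assumes "large C"
  obtains A B where "large A" "large B" "A \<subseteq> C" "B \<subseteq> C" "A \<inter> B = {}"
proof -
  obtain e where e: "embeds bool_lex (X \<times> UNIV) e C"
    using embedding_exists_bool_lex[OF assms] by auto
  let ?D = "\<lambda>j. (\<lambda>x. e (x, j)) ` X"
  have eq: "x = x' \<and> j = j'" if "e (x, j) = e (x', j')" "x \<in> X" "x' \<in> X" for x x' j j'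
    using inj_onD[OF embedsD(2)[OF e] that(1)] that(2,3) by simp
  have sub: "?D j \<subseteq> C" for j using embedsD(1)[OF e] by auto
  have CX: "C \<subseteq> X" using assms by (simp add: large_def)
  have "large (?D j)" for j
  proof (rule large_image[OF _ large_UNIV])
    show "inj_on (\<lambda>x. e (x, j)) X" by (rule inj_onI) (use eq in blast)
    show "?D j \<subseteq> X" using sub[of j] CX by (rule subset_trans)
  qed
  moreover have "?D True \<inter> ?D False = {}" using eq by blast
  ultimately show thesis using that[of "?D True" "?D False"] sub by simp
qed

text \<open>
  \<open>b w\<close> bounds everything that \<open>F\<close> or its inverse connects to a point below \<open>w\<close>, so along a
  sparse set of cut points no step from \<open>x\<close> to \<open>F x\<close> crosses two cuts.
\<close>

lemma cuts_exist:
  assumes "D \<subseteq> X" "inj_on F D" "F ` D \<subseteq> X"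
  obtains C where "large C" "\<And>h h' x. h \<in> C \<Longrightarrow> h' \<in> C \<Longrightarrow> h \<noteq> h' \<Longrightarrow> x \<in> D \<Longrightarrow>
    (x \<sqsubseteq> h \<longleftrightarrow> F x \<sqsubseteq> h) \<or> (x \<sqsubseteq> h' \<longleftrightarrow> F x \<sqsubseteq> h')"
proof -
  have "\<exists>b. b \<in> X \<and> (\<forall>x\<in>D. x \<sqsubseteq> w \<longrightarrow> F x \<sqsubset> b) \<and> (\<forall>x\<in>D. F x \<sqsubseteq> w \<longrightarrow> x \<sqsubset> b)" if w: "w \<in> X" for w
  proof -
    have seg: "small {y \<in> X. y \<sqsubseteq> w}" using small_segment[OF w] .
    have 1: "small {x \<in> D. x \<sqsubseteq> w}"
      by (rule small_subset[OF _ seg]) (use assms(1) in auto)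
    \<comment> \<open>Injectivity of \<open>F\<close> is what makes this preimage of a segment
      small.\<close>
    have 2: "small {x \<in> D. F x \<sqsubseteq> w}"
    proof (rule small_subset)
      show "small (inv_into D F ` {y \<in> X. y \<sqsubseteq> w})" using small_image[OF seg] .
      show "{x \<in> D. F x \<sqsubseteq> w} \<subseteq> inv_into D F ` {y \<in> X. y \<sqsubseteq> w}"
      proof
        fix x assume x: "x \<in> {x \<in> D. F x \<sqsubseteq> w}"
        then have "x = inv_into D F (F x)" using inv_into_f_f[OF assms(2)] by simp
        moreover have "F x \<in> {y \<in> X. y \<sqsubseteq> w}" using x assms(3) by blast
        ultimately show "x \<in> inv_into D F ` {y \<in> X. y \<sqsubseteq> w}" by (rule image_eqI)
      qed
    qed
    have "small (F ` {x \<in> D. x \<sqsubseteq> w} \<union> {x \<in> D. F x \<sqsubseteq> w})"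
      by (rule small_Un[OF small_image[OF 1] 2])
    from small_bounded[OF _ this] obtain b where "b \<in> X"
      and "\<And>s. s \<in> F ` {x \<in> D. x \<sqsubseteq> w} \<union> {x \<in> D. F x \<sqsubseteq> w} \<Longrightarrow> s \<sqsubset> b"
      using assms(1,3) by blast
    then show ?thesis by (intro exI[of _ b]) auto
  qed
  then have "\<forall>w\<in>X. \<exists>b. b \<in> X \<and> (\<forall>x\<in>D. x \<sqsubseteq> w \<longrightarrow> F x \<sqsubset> b) \<and> (\<forall>x\<in>D. F x \<sqsubseteq> w \<longrightarrow> x \<sqsubset> b)"
    by (rule ballI)
  from bchoice[OF this] obtain b where b: "\<And>w. w \<in> X \<Longrightarrow> b w \<in> X"
    "\<And>w x. w \<in> X \<Longrightarrow> x \<in> D \<Longrightarrow> x \<sqsubseteq> w \<Longrightarrow> F x \<sqsubset> b w"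
    "\<And>w x. w \<in> X \<Longrightarrow> x \<in> D \<Longrightarrow> F x \<sqsubseteq> w \<Longrightarrow> x \<sqsubset> b w" by blast
  obtain C where C: "large C" "\<And>x y. x \<in> C \<Longrightarrow> y \<in> C \<Longrightarrow> x \<sqsubset> y \<Longrightarrow> b x \<sqsubset> y"
    by (rule sparse_subset[OF large_UNIV b(1)]) (assumption, rule that)
  \<comment> \<open>If \<open>h\<close> separates \<open>x\<close> from \<open>F x\<close>, one of
    the two is at or below \<open>h\<close>, so the other is below \<open>b h\<close> and both are
    below the next cut \<open>h'\<close>.\<close>
  have *: "x \<sqsubseteq> h' \<longleftrightarrow> F x \<sqsubseteq> h'"
    if hx: "h \<in> C" "h' \<in> C" "h \<sqsubset> h'" "x \<in> D" and cross: "(x \<sqsubseteq> h) \<noteq> (F x \<sqsubseteq> h)" for h h' x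
  proof -
    have hX: "h \<in> X" using largeD[OF C(1) hx(1)] .
    have bh: "b h \<sqsubset> h'" using C(2)[OF hx(1-3)] .
    consider "x \<sqsubseteq> h" | "F x \<sqsubseteq> h" using cross by blast
    then show ?thesis
    proof cases
      case 1
      then have "F x \<sqsubset> h'" using b(2)[OF hX hx(4)] bh less_trans by blast
      moreover have "x \<sqsubset> h'" using 1 hx(3) less_trans by blast
      ultimately show ?thesis by simp
    next
      case 2
      then have "x \<sqsubset> h'" using b(3)[OF hX hx(4)] bh less_trans by blast
      moreover have "F x \<sqsubset> h'" using 2 hx(3) less_trans by metis
      ultimately show ?thesis by simp
    qed
  qed
  show thesis
  proof (rule that[OF C(1)])
    fix h h' x assume h: "h \<in> C" "h' \<in> C" "h \<noteq> h'" "x \<in> D"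
    consider "h \<sqsubset> h'" | "h' \<sqsubset> h" using less_total[OF largeD[OF C(1) h(1)] largeD[OF C(1) h(2)] h(3)] by blast
    then show "(x \<sqsubseteq> h \<longleftrightarrow> F x \<sqsubseteq> h) \<or> (x \<sqsubseteq> h' \<longleftrightarrow> F x \<sqsubseteq> h')"
      by cases (use *[of h h' x] *[of h' h x] h in blast)+
  qed
qed

text \<open>
  Working in two copies of \<open>X\<close>, one for each set of cuts, keeps the values of the two block
  preserving factors apart.
\<close>

lemma sym_inv_monoid_subset_sgen:
  assumes \<theta>: "embeds less_rel X \<theta> H" and z: "embeds triple_lex triples z H" and H: "large H"
    and V: "order_charts H \<subseteq> V" "chart X id \<theta> \<in> V" "chart X \<theta> id \<in> V" "swap_chart z \<in> V"
  shows "sym_inv_monoid X \<subseteq> sgen V"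
proof
  fix f assume f: "f \<in> sym_inv_monoid X"
  define D where "D = dom f"
  define F where "F = (\<lambda>x. the (f x))"
  have f_eq: "f = chart D id F" and F: "inj_on F D" "F ` D \<subseteq> X" and D: "D \<subseteq> X"
    using sym_inv_monoid_chart[OF f] by (simp_all add: D_def F_def)
  have DX: "x \<in> X" and FX: "F x \<in> X" if "x \<in> D" for x using that D F(2) by auto
  obtain C where C: "large C" "\<And>h h' x. h \<in> C \<Longrightarrow> h' \<in> C \<Longrightarrow> h \<noteq> h' \<Longrightarrow> x \<in> D \<Longrightarrow>
    (x \<sqsubseteq> h \<longleftrightarrow> F x \<sqsubseteq> h) \<or> (x \<sqsubseteq> h' \<longleftrightarrow> F x \<sqsubseteq> h')"
    by (rule cuts_exist[OF D F]) (rule that; assumption)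
  obtain A B where AB: "large A" "large B" "A \<subseteq> C" "B \<subseteq> C" "A \<inter> B = {}"
    by (rule large_split[OF C(1)])
  \<comment> \<open>\<open>t x\<close> says that the step from \<open>x\<close> to
    \<open>F x\<close> crosses no cut of \<open>A\<close>. If it does cross one, it can cross no cut
    of \<open>B\<close>, since \<open>A\<close> and \<open>B\<close> are disjoint subsets of
    \<open>C\<close>.\<close>
  define t where "t x \<longleftrightarrow> (\<forall>h\<in>A. x \<sqsubseteq> h \<longleftrightarrow> F x \<sqsubseteq> h)" for x
  have tA: "x \<sqsubseteq> h \<longleftrightarrow> F x \<sqsubseteq> h" if "t x" "h \<in> A" for x h using that unfolding t_def by blast
  have tB: "x \<sqsubseteq> h \<longleftrightarrow> F x \<sqsubseteq> h" if xh: "x \<in> D" "\<not> t x" "h \<in> B" for x h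
  proof -
    obtain h' where h': "h' \<in> A" "\<not> (x \<sqsubseteq> h' \<longleftrightarrow> F x \<sqsubseteq> h')" using xh(2) unfolding t_def by blast
    moreover have "h \<noteq> h'" using h'(1) xh(3) AB(5) by blast
    ultimately show ?thesis using C(2)[of h h' x] xh AB(3,4) by blast
  qed
  obtain e where e: "embeds bool_lex (X \<times> UNIV) e H"
    using embedding_exists_bool_lex[OF H] by auto
  have HX: "H \<subseteq> X" using H by (simp add: large_def)
  have e_in: "e (x, j) \<in> H" if "x \<in> X" for x j using embedsD(1)[OF e] that by simp
  have e_eq: "e (x, j) = e (x', j') \<longleftrightarrow> x = x' \<and> j = j'" if "x \<in> X" "x' \<in> X" for x x' j j'
    using inj_on_eq_iff[OF embedsD(2)[OF e]] that by simp
  have e_less: "e (x, j) \<sqsubset> e (x', j') \<longleftrightarrow> x \<sqsubset> x' \<or> x = x' \<and> \<not> j \<and> j'"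
    if "x \<in> X" "x' \<in> X" for x x' j j'
    using embedsD(3)[OF e, of "(x, j)" "(x', j')"] that by simp
  \<comment> \<open>Cuts sit at the \<open>True\<close> copy, the later one, so that both copies of
    \<open>h\<close> count as at or below the cut.\<close>
  have e_cut: "e (x, j) \<sqsubseteq> e (h, True) \<longleftrightarrow> x \<sqsubseteq> h" if "x \<in> X" "h \<in> X" for x h j
    using that by (auto simp: e_eq e_less)
  have large_cut: "large ((\<lambda>h. e (h, True)) ` S)" if S: "large S" for S
  proof (rule large_image[OF _ S])
    show "inj_on (\<lambda>h. e (h, True)) S" by (rule inj_onI) (simp add: e_eq largeD[OF S])
    show "(\<lambda>h. e (h, True)) ` S \<subseteq> X" using e_in largeD[OF S] HX by blast
  qed
  \<comment> \<open>The intermediate position: the factor preserving the blocks of \<open>A\<close>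
    moves the points with \<open>t x\<close>, and the factor for \<open>B\<close> moves the
    others.\<close>
  define G where "G x = (if t x then F x else x)" for x
  have GX: "G x \<in> X" if "x \<in> D" for x using that DX FX by (simp add: G_def)
  define a where "a x = e (x, t x)" for x
  define m where "m x = e (G x, t x)" for x
  define c where "c x = e (F x, t x)" for x
  have F_eq: "F x = F y \<longleftrightarrow> x = y" if "x \<in> D" "y \<in> D" for x y
    using inj_on_eq_iff[OF F(1)] that by simp
  have inj: "inj_on a D" "inj_on m D" "inj_on c D"
    by (auto simp: inj_on_def a_def m_def c_def e_eq DX FX GX F_eq G_def)
  have im: "a ` D \<subseteq> H" "m ` D \<subseteq> H" "c ` D \<subseteq> H"
    using e_in DX FX GX by (auto simp: a_def m_def c_def)
  note imX = im[THEN subset_trans, OF HX]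
  have fA: "chart D a m \<in> sgen V"
  proof (rule block_preserving_in_sgen[OF \<theta> z V inj(1) imX(1) inj(2) imX(2) large_cut[OF AB(1)]])
    fix x h' assume x: "x \<in> D" and "h' \<in> (\<lambda>h. e (h, True)) ` A"
    then obtain h where h: "h \<in> A" "h' = e (h, True)" by blast
    then show "a x \<sqsubseteq> h' \<longleftrightarrow> m x \<sqsubseteq> h'"
      unfolding a_def m_def h(2) e_cut[OF DX[OF x] largeD[OF AB(1) h(1)]]
        e_cut[OF GX[OF x] largeD[OF AB(1) h(1)]]
      using tA[of x h] h(1) by (simp add: G_def)
  qed
  have fB: "chart D m c \<in> sgen V"
  proof (rule block_preserving_in_sgen[OF \<theta> z V inj(2) imX(2) inj(3) imX(3) large_cut[OF AB(2)]])
    fix x h' assume x: "x \<in> D" and "h' \<in> (\<lambda>h. e (h, True)) ` B"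
    then obtain h where h: "h \<in> B" "h' = e (h, True)" by blast
    then show "m x \<sqsubseteq> h' \<longleftrightarrow> c x \<sqsubseteq> h'"
      unfolding c_def m_def h(2) e_cut[OF FX[OF x] largeD[OF AB(2) h(1)]]
        e_cut[OF GX[OF x] largeD[OF AB(2) h(1)]]
      using tB[OF x _ h(1)] by (simp add: G_def)
  qed
  have inj_\<theta>: "inj_on \<theta> D" using inj_on_subset[OF embedsD(2)[OF \<theta>] D] .
  have "chart D \<theta> a \<in> order_charts H"
  proof (rule chart_in_order_charts[OF inj_\<theta> _ im(1)])
    show "\<theta> ` D \<subseteq> H" using embedsD(1)[OF \<theta> DX] by blast
    fix x y assume "x \<in> D" "y \<in> D" "\<theta> x \<sqsubset> \<theta> y"
    then show "a x \<sqsubset> a y" using embedsD(3)[OF \<theta> DX DX] by (simp add: a_def e_less DX)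
  qed
  then have s1: "chart D \<theta> a \<in> sgen V" using V(1) by (auto intro: sgen.base)
  have "chart D c (\<lambda>x. \<theta> (F x)) \<in> order_charts H"
  proof (rule chart_in_order_charts[OF inj(3) im(3)])
    show "(\<lambda>x. \<theta> (F x)) ` D \<subseteq> H" using embedsD(1)[OF \<theta> FX] by blast
    fix x y assume xy: "x \<in> D" "y \<in> D" "c x \<sqsubset> c y"
    \<comment> \<open>A comparison decided by the tags alone would need \<open>F x = F y\<close>,
      hence \<open>x = y\<close> and equal tags.\<close>
    then have "F x \<sqsubset> F y" by (auto simp: c_def e_less FX F_eq)
    then show "\<theta> (F x) \<sqsubset> \<theta> (F y)" using embedsD(3)[OF \<theta> FX FX] xy by simp
  qed
  then have s2: "chart D c (\<lambda>x. \<theta> (F x)) \<in> sgen V" using V(1) by (auto intro: sgen.base)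
  have "chart X id \<theta> \<cdot>\<^sub>c chart D \<theta> a = chart D id a"
    using chart_mult_left[OF _ embedsD(2)[OF \<theta>], of id id D a] D by (simp add: id_def)
  then have "chart D id a \<in> sgen V" by (rule sgen_mult_eq[OF sgen.base[OF V(2)] s1])
  then have "chart D id m \<in> sgen V" by (rule sgen_mult_eq[OF _ fA chart_mult[OF inj_on_id inj(1)]])
  then have "chart D id c \<in> sgen V" by (rule sgen_mult_eq[OF _ fB chart_mult[OF inj_on_id inj(2)]])
  then have "chart D id (\<lambda>x. \<theta> (F x)) \<in> sgen V"
    by (rule sgen_mult_eq[OF _ s2 chart_mult[OF inj_on_id inj(3)]])
  moreover have "chart D id (\<lambda>x. \<theta> (F x)) \<cdot>\<^sub>c chart X \<theta> id = f"
    using chart_mult_right[OF inj_on_id embedsD(2)[OF \<theta>] F(2), of id] f_eq by simp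
  ultimately show "f \<in> sgen V" by (rule sgen_mult_eq[OF _ sgen.base[OF V(3)]])
qed

text \<open>The embeddings \<open>\<theta>\<close> and \<open>z\<close> depend only on
  \<open>H\<close>, so the same three charts serve for every member of the symmetric inverse
  monoid.\<close>

lemma sym_inv_monoid_preceq_order_charts:
  assumes H: "large H" and S: "order_charts H \<subseteq> S"
  shows "preceq_I X (sym_inv_monoid X) S"
proof -
  obtain \<theta> where \<theta>: "embeds less_rel X \<theta> H" using embedding_exists_less[OF H] by auto
  obtain z where z: "embeds triple_lex triples z H" using embedding_exists_triple_lex[OF H] by auto
  let ?U = "{chart X id \<theta>, chart X \<theta> id, swap_chart z}"
  have HX: "H \<subseteq> X" using H by (simp add: large_def)
  have \<theta>X: "\<theta> ` X \<subseteq> X" using embedsD(1)[OF \<theta>] HX by blast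
  have zX: "z ` triples \<subseteq> X" using embedsD(1)[OF z] HX by blast
  have "inj_on (\<lambda>(v, x, y). z (v, y, x)) triples"
  proof (rule inj_onI)
    fix p q assume pq: "p \<in> triples" "q \<in> triples"
      "(case p of (v, x, y) \<Rightarrow> z (v, y, x)) = (case q of (v, x, y) \<Rightarrow> z (v, y, x))"
    obtain v x y v' x' y' where eq: "p = (v, x, y)" "q = (v', x', y')" by (cases p, cases q) auto
    have "(v, y, x) = (v', y', x')"
      by (rule inj_onD[OF embedsD(2)[OF z]]) (use pq swap_triples in \<open>simp_all add: eq\<close>)
    then show "p = q" by (simp add: eq)
  qed
  moreover have "(\<lambda>(v, x, y). z (v, y, x)) ` triples \<subseteq> X"
  proof (rule image_subsetI)
    fix p assume "p \<in> triples"
    then show "(case p of (v, x, y) \<Rightarrow> z (v, y, x)) \<in> X"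
      using zX swap_triples by (cases p) (auto simp: image_subset_iff)
  qed
  ultimately have "swap_chart z \<in> sym_inv_monoid X"
    unfolding swap_chart_def by (rule chart_in_sym_inv_monoid[OF embedsD(2)[OF z] _ zX])
  then have "?U \<subseteq> sym_inv_monoid X"
    using chart_in_sym_inv_monoid[OF inj_on_id embedsD(2)[OF \<theta>] _ \<theta>X]
      chart_in_sym_inv_monoid[OF embedsD(2)[OF \<theta>] inj_on_id \<theta>X] by simp
  moreover have "sym_inv_monoid X \<subseteq> sgen (S \<union> ?U)"
    by (rule sym_inv_monoid_subset_sgen[OF \<theta> z H]) (use S in auto)
  ultimately show ?thesis unfolding preceq_I_def by (intro exI[of _ ?U]) simp
qed

end

section \<open>The finite case, the trivial inclusion and the choice of the well-order\<close>

lemma finite_sym_inv_monoid: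
  assumes "finite X"
  shows "finite (sym_inv_monoid X)"
proof (rule finite_subset)
  show "finite {f :: 'a \<rightharpoonup> 'a. dom f \<subseteq> X \<and> ran f \<subseteq> X}"
  proof -
    have "{f :: 'a \<rightharpoonup> 'a. dom f \<subseteq> X \<and> ran f \<subseteq> X} = (\<Union>D\<in>Pow X. {f. dom f = D \<and> ran f \<subseteq> X})" by auto
    also have "finite \<dots>"
      using assms finite_subset by (intro finite_UN_I finite_set_of_finite_maps) auto
    finally show ?thesis .
  qed
qed (auto simp: sym_inv_monoid_def)

lemma pAut_preceq_sym_inv_monoid: "preceq_I X (pAut X Rs ar) (sym_inv_monoid X)"
  unfolding preceq_I_def by (intro exI[of _ "{}"]) (auto simp: pAut_def intro: sgen.base)

text \<open>The cardinal \<open>|X|\<close> is itself a well-order of \<open>X\<close> of least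
  possible type. Its strict part therefore has small initial segments and can serve as the order of
  the locale.\<close>

lemma ramsey_order_card_of:
  assumes "Card_order \<kappa>" "|X| =o \<kappa>" "partition_arrow \<kappa> \<kappa> 2 ctwo" "infinite X"
  shows "ramsey_order X (\<lambda>x y. (x, y) \<in> |X| - Id)"
proof -
  have wo: "well_order_on X |X|" using card_of_well_order_on .
  then have lin: "linear_order_on X |X|" and wf: "wf ( |X| - Id)" by (auto simp: well_order_on_def)
  have "trans ( |X| - Id)" using lin
    by (simp add: trans_diff_Id linear_order_on_def partial_order_on_def preorder_on_def)
  note tr = transD[OF this]
  have asym: "(y, x) \<notin> |X| - Id" if "(x, y) \<in> |X| - Id" for x y using wf_not_sym[OF wf that] .
  show ?thesis
  proof
    show "infinite X" by fact
    show "wf {(x, y). (x, y) \<in> |X| - Id}" using wf by (rule back_subst[of wf]) auto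
    show "(x, z) \<in> |X| - Id" if "(x, y) \<in> |X| - Id" "(y, z) \<in> |X| - Id" for x y z
      using tr that by blast
    show "(x, y) \<in> |X| - Id \<or> (y, x) \<in> |X| - Id" if "x \<in> X" "y \<in> X" "x \<noteq> y" for x y
      using lin that by (auto simp: linear_order_on_def total_on_def)
    show "|{y \<in> X. (y, x) \<in> |X| - Id}| <o |X|" if "x \<in> X" for x
    proof -
      have "{y \<in> X. (y, x) \<in> |X| - Id} \<subseteq> underS |X| x" by (auto simp: underS_def)
      then have "|{y \<in> X. (y, x) \<in> |X| - Id}| \<le>o |underS |X| x|" by (rule card_of_mono1)
      also have "|underS |X| x| <o |X|"
        by (rule card_of_underS[OF card_of_Card_order]) (simp add: Field_card_of that)
      finally show ?thesis .
    qed
    show "\<exists>H\<subseteq>Y. |H| =o |Y| \<and> ((\<forall>x\<in>H. \<forall>y\<in>H. (x, y) \<in> |X| - Id \<longrightarrow> Q x y) \<or>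
        (\<forall>x\<in>H. \<forall>y\<in>H. (x, y) \<in> |X| - Id \<longrightarrow> \<not> Q x y))"
      if "Y \<subseteq> X" "|Y| =o |X|" for Y Q
      by (rule partition_arrow_two_colours[OF assms(3,1) ordIso_transitive[OF that(2) assms(2)] asym])
  qed
qed

theorem theorem4p25:
  fixes X :: "'a set"
    and \<kappa> :: "'k rel"
    and Rs :: "'a list set set"
    and ar :: "'a list set \<Rightarrow> nat"
  assumes "Card_order \<kappa>"
    and "|X| =o \<kappa>"
    and "partition_arrow \<kappa> \<kappa> 2 ctwo"
    and "relational_structure X Rs ar"
    and "|Rs| <o \<kappa>"
    and "bdd_above (ar ` Rs)"
  shows "approx_I X (pAut X Rs ar) (sym_inv_monoid X)"
proof -
  have "preceq_I X (sym_inv_monoid X) (pAut X Rs ar)"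
  proof (cases "finite X")
    case True
    then show ?thesis unfolding preceq_I_def
      using finite_sym_inv_monoid by (intro exI[of _ "sym_inv_monoid X"]) (auto intro: sgen.base)
  next
    case False
    interpret ramsey_order X "\<lambda>x y. (x, y) \<in> |X| - Id"
      by (rule ramsey_order_card_of[OF assms(1-3) False])
    have "small Rs" using ordLess_ordIso_trans[OF assms(5) ordIso_symmetric[OF assms(2)]] .
    then obtain H where "large H" "order_charts H \<subseteq> pAut X Rs ar"
      by (rule order_charts_subset_pAut[OF _ assms(6)])
    then show ?thesis by (rule sym_inv_monoid_preceq_order_charts)
  qed
  then show ?thesis by (simp add: approx_I_def pAut_preceq_sym_inv_monoid)
qed

end
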